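(* Let $\mathbb K$ be a field and let $\Phi=(A,A^*;E_i,E^*_i,i=0..d)$ be a Leonard system over $\mathbb K$ which is in $TD$-$D$ canonical form. Let $p$ be the parameter array of $\Phi$. Then $A=p^T$ and $A^*=p^D$.
   Context: $\mathrm{Mat}_{d+1}(\mathbb K)$ is the algebra of $(d+1)\times(d+1)$ matrices over $\mathbb K$, rows and columns indexed by $0,1,\dots,d$. A matrix is tridiagonal if every nonzero entry lies on the diagonal, subdiagonal or superdiagonal. Leonard systems. Let $\mathcal A$ be a $\mathbb K$-algebra isomorphic to $\mathrm{Mat}_{d+1}(\mathbb K)$. An element $A\in\mathcal A$ is multiplicity-free if it has $d+1$ distinct eigenvalues in $\mathbb K$; if these are $\theta_0,\dots,\theta_d$, the primitive idempotent of $A$ associated with $\theta_i$ is $E_i=\prod_{j\ne i}(A-\theta_jI)/(\theta_i-\theta_j)$. For multiplicity-free $A,A^*\in\mathcal A$ ($A^*$ is just a name, not an adjoint), an idempotent sequence for $A,A^*$ is an ordering $E_0,\dots,E_d$ of the primitive idempotents of $A$ such that $E_iA^*E_j=0$ if $|i-j|>1$ and $E_iA^*E_j\ne0$ if $|i-j|=1$ ($0\le i,j\le d$); a dual idempotent sequence for $A,A^*$ is an idempotent sequence for $A^*,A$. A Leonard system in $\mathcal A$ (with ambient algebra $\mathcal A$, over $\mathbb K$) is a sequence $\Phi=(A,A^*;E_i,E^*_i,i=0..d)$ where $A,A^*\in\mathcal A$ are multiplicity-free, $E_0,\dots,E_d$ is an idempotent sequence for $A,A^*$ and $E^*_0,\dots,E^*_d$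 is a dual idempotent sequence for $A,A^*$. The eigenvalue sequence (resp. dual eigenvalue sequence) of $\Phi$ is $\theta_0,\dots,\theta_d$ (resp. $\theta^*_0,\dots,\theta^*_d$), where $\theta_i$ (resp. $\theta^*_i$) is the eigenvalue of $A$ (resp. $A^*$) associated with $E_i$ (resp. $E^*_i$). Split sequences. Let $V$ be an irreducible left $\mathcal A$-module (unique up to isomorphism, of dimension $d+1$) and set $U_i=(E^*_0V+\cdots+E^*_iV)\cap(E_iV+\cdots+E_dV)$. It is known that each $U_i$ has dimension 1, $V$ is the direct sum of $U_0,\dots,U_d$, $(A-\theta_iI)U_i=U_{i+1}$ ($0\le i\le d-1$), $(A-\theta_dI)U_d=0$, $(A^*-\theta^*_iI)U_i=U_{i-1}$ ($1\le i\le d$), $(A^*-\theta_0^*I)U_0=0$. For $1\le i\le d$, $\varphi_i$ is the (nonzero) eigenvalue of $(A-\theta_{i-1}I)(A^*-\theta^*_iI)$ on $U_i$. The sequence $\varphi_1,\dots,\varphi_d$ is the first split sequence of $\Phi$. The second split sequence $\phi_1,\dots,\phi_d$ of $\Phi$ is the first split sequence of the Leonard system $\Phi^\Downarrow=(A,A^*;E_{d-i},E^*_i,i=0..d)$. The parameter array of $\Phi$ is $p=(\theta_i,\theta^*_i,i=0..d;\varphi_j,\phi_j,j=1..d)$, formed from its eigenvalue sequence, dual eigenvalue sequence, first split sequence and second split sequence. The matrices $p^T,p^D$. For the parameter array $p=(\theta_i,\theta^*_i,i=0..d;\varphi_j,\phi_j,j=1..d)$ of a Leonard system, $p^T\in\mathrm{Mat}_{d+1}(\mathbb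 K)$ is the tridiagonal matrix with diagonal entries $p^T_{ii}=\theta_i+\frac{\varphi_i}{\theta^*_i-\theta^*_{i-1}}+\frac{\varphi_{i+1}}{\theta^*_i-\theta^*_{i+1}}$ ($0\le i\le d$), where $\varphi_0=\varphi_{d+1}=0$ and $\theta^*_{-1},\theta^*_{d+1}$ are indeterminates (so terms with numerator $\varphi_0$ or $\varphi_{d+1}$ vanish), and, for $1\le i\le d$, $$p^T_{i-1,i}=\varphi_i\frac{\prod_{h=0}^{i-2}(\theta^*_{i-1}-\theta^*_h)}{\prod_{h=0}^{i-1}(\theta^*_i-\theta^*_h)},\qquad p^T_{i,i-1}=\phi_i\frac{\prod_{h=i+1}^{d}(\theta^*_i-\theta^*_h)}{\prod_{h=i}^{d}(\theta^*_{i-1}-\theta^*_h)}.$$ Also $p^D=\mathrm{diag}(\theta^*_0,\theta^*_1,\dots,\theta^*_d)$. $TD$-$D$ canonical form. A Leonard system $\Phi=(A,A^*;E_i,E^*_i,i=0..d)$ with eigenvalue sequence $\theta_0,\dots,\theta_d$ and dual eigenvalue sequence $\theta^*_0,\dots,\theta^*_d$ is in $TD$-$D$ canonical form if (i) its ambient algebra is $\mathrm{Mat}_{d+1}(\mathbb K)$; (ii) $A$ is tridiagonal and $A^*$ is diagonal; (iii) every row sum of $A$ equals $\theta_0$, and $A^*_{00}=\theta^*_0$. *)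

theory Defs
  imports "Jordan_Normal_Form.Char_Poly"
begin

text \<open>
  Throughout, \<open>d\<close> is an arbitrary natural number and the ambient algebra
  is the algebra of all matrices in \<open>carrier_mat (d + 1) (d + 1)\<close>, with rows and columns
  indexed by \<open>0, \<dots>, d\<close>.  Its irreducible left module is the space
  \<open>carrier_vec (d + 1)\<close> of column vectors.  Sequences \<open>x\<^sub>0, \<dots>, x\<^sub>d\<close>
  and \<open>x\<^sub>1, \<dots>, x\<^sub>d\<close> are functions on \<open>nat\<close> whose values outside
  the index range are irrelevant.
\<close>

definition multiplicity_free :: "nat \<Rightarrow> 'a::field mat \<Rightarrow> bool" where
  "multiplicity_free d A \<longleftrightarrow>
     A \<in> carrier_mat (d + 1) (d + 1) \<and> card {t. eigenvalue A t} = d + 1"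

definition eigenvalue_ordering :: "nat \<Rightarrow> 'a::field mat \<Rightarrow> (nat \<Rightarrow> 'a) \<Rightarrow> bool" where
  "eigenvalue_ordering d A \<theta> \<longleftrightarrow> bij_betw \<theta> {0..d} {t. eigenvalue A t}"

text \<open>The factors commute, so taking the product in increasing order of \<open>j\<close> is immaterial.\<close>

definition primitive_idempotent :: "nat \<Rightarrow> 'a::field mat \<Rightarrow> (nat \<Rightarrow> 'a) \<Rightarrow> nat \<Rightarrow> 'a mat" where
  "primitive_idempotent d A \<theta> i =
     foldr (*) (map (\<lambda>j. (1 / (\<theta> i - \<theta> j)) \<cdot>\<^sub>m (A - \<theta> j \<cdot>\<^sub>m 1\<^sub>m (d + 1)))
                    (filter (\<lambda>j. j \<noteq> i) [0..<d + 1])) (1\<^sub>m (d + 1))"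

definition associated_eigenvalues ::
    "nat \<Rightarrow> 'a::field mat \<Rightarrow> (nat \<Rightarrow> 'a mat) \<Rightarrow> (nat \<Rightarrow> 'a) \<Rightarrow> bool" where
  "associated_eigenvalues d A E \<theta> \<longleftrightarrow>
     eigenvalue_ordering d A \<theta> \<and> (\<forall>i\<le>d. E i = primitive_idempotent d A \<theta> i)"

definition idempotent_sequence ::
    "nat \<Rightarrow> 'a::field mat \<Rightarrow> 'a mat \<Rightarrow> (nat \<Rightarrow> 'a mat) \<Rightarrow> bool" where
  "idempotent_sequence d A As E \<longleftrightarrow>
     (\<exists>\<theta>. associated_eigenvalues d A E \<theta>) \<and>
     (\<forall>i\<le>d. \<forall>j\<le>d.
        (\<bar>int i - int j\<bar> > 1 \<longrightarrow> E i * As * E j = 0\<^sub>m (d + 1) (d + 1)) \<and>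
        (\<bar>int i - int j\<bar> = 1 \<longrightarrow> E i * As * E j \<noteq> 0\<^sub>m (d + 1) (d + 1)))"

text \<open>The fields are \<open>A\<close>, \<open>A\<^sup>*\<close>, \<open>E\<^sub>i\<close> and \<open>E\<^sup>*\<^sub>i\<close>.\<close>

record 'a leonard_data =
  op :: "'a mat"
  dual_op :: "'a mat"
  idem :: "nat \<Rightarrow> 'a mat"
  dual_idem :: "nat \<Rightarrow> 'a mat"

definition leonard_system :: "nat \<Rightarrow> 'a::field leonard_data \<Rightarrow> bool" where
  "leonard_system d \<Phi> \<longleftrightarrow>
     multiplicity_free d (op \<Phi>) \<and> multiplicity_free d (dual_op \<Phi>) \<and>
     idempotent_sequence d (op \<Phi>) (dual_op \<Phi>) (idem \<Phi>) \<and>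
     idempotent_sequence d (dual_op \<Phi>) (op \<Phi>) (dual_idem \<Phi>)"

text \<open>
  For a Leonard system, the sequences chosen below exist, and their values at
  \<open>0, \<dots>, d\<close> are unique.
\<close>

definition eigenvalue_seq :: "nat \<Rightarrow> 'a::field leonard_data \<Rightarrow> nat \<Rightarrow> 'a" where
  "eigenvalue_seq d \<Phi> = (SOME \<theta>. associated_eigenvalues d (op \<Phi>) (idem \<Phi>) \<theta>)"

definition dual_eigenvalue_seq :: "nat \<Rightarrow> 'a::field leonard_data \<Rightarrow> nat \<Rightarrow> 'a" where
  "dual_eigenvalue_seq d \<Phi> = (SOME \<theta>. associated_eigenvalues d (dual_op \<Phi>) (dual_idem \<Phi>) \<theta>)"

text \<open>The sum of the subspaces \<open>E\<^sub>j V\<close>, where \<open>j\<close> ranges over a finite index set.\<close>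

definition idem_image_sum :: "nat \<Rightarrow> (nat \<Rightarrow> 'a::field mat) \<Rightarrow> nat set \<Rightarrow> 'a vec set" where
  "idem_image_sum d E J =
     {finsum_vec TYPE('a) (d + 1) (\<lambda>j. E j *\<^sub>v v j) J | v. \<forall>j\<in>J. v j \<in> carrier_vec (d + 1)}"

definition split_space :: "nat \<Rightarrow> 'a::field leonard_data \<Rightarrow> nat \<Rightarrow> 'a vec set" where
  "split_space d \<Phi> i =
     idem_image_sum d (dual_idem \<Phi>) {0..i} \<inter> idem_image_sum d (idem \<Phi>) {i..d}"

text \<open>
  Meaningful for \<open>1 \<le> i \<le> d\<close>, where the split space is one-dimensional and
  invariant under the given product, so that the eigenvalue exists and is unique.
\<close>

definition first_split_seq :: "nat \<Rightarrow> 'a::field leonard_data \<Rightarrow> nat \<Rightarrow> 'a" where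
  "first_split_seq d \<Phi> i =
     (THE c. \<exists>u\<in>split_space d \<Phi> i.
        eigenvector ((op \<Phi> - eigenvalue_seq d \<Phi> (i - 1) \<cdot>\<^sub>m 1\<^sub>m (d + 1)) *
                     (dual_op \<Phi> - dual_eigenvalue_seq d \<Phi> i \<cdot>\<^sub>m 1\<^sub>m (d + 1))) u c)"

definition down :: "nat \<Rightarrow> 'a leonard_data \<Rightarrow> 'a leonard_data" where
  "down d \<Phi> = \<Phi>\<lparr>idem := (\<lambda>i. idem \<Phi> (d - i))\<rparr>"

definition second_split_seq :: "nat \<Rightarrow> 'a::field leonard_data \<Rightarrow> nat \<Rightarrow> 'a" where
  "second_split_seq d \<Phi> = first_split_seq d (down d \<Phi>)"

record 'a param_array =
  eigval :: "nat \<Rightarrow> 'a"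
  dual_eigval :: "nat \<Rightarrow> 'a"
  split1 :: "nat \<Rightarrow> 'a"
  split2 :: "nat \<Rightarrow> 'a"

definition parameter_array :: "nat \<Rightarrow> 'a::field leonard_data \<Rightarrow> 'a param_array" where
  "parameter_array d \<Phi> =
     \<lparr>eigval = eigenvalue_seq d \<Phi>, dual_eigval = dual_eigenvalue_seq d \<Phi>,
      split1 = first_split_seq d \<Phi>, split2 = second_split_seq d \<Phi>\<rparr>"

text \<open>
  The first split sequence is extended by zero to the indices \<open>0\<close> and \<open>d + 1\<close>;
  this is built in by dropping the corresponding summands of the diagonal entries.
\<close>

definition matrix_T :: "nat \<Rightarrow> 'a::field param_array \<Rightarrow> 'a mat" where
  "matrix_T d p = (let \<theta> = eigval p; \<theta>s = dual_eigval p in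
     mat (d + 1) (d + 1) (\<lambda>(r, c).
       if r = c then
         \<theta> r + (if r = 0 then 0 else split1 p r / (\<theta>s r - \<theta>s (r - 1)))
             + (if r = d then 0 else split1 p (r + 1) / (\<theta>s r - \<theta>s (r + 1)))
       else if c = r + 1 then
         split1 p c * (\<Prod>h\<in>{0..<c - 1}. \<theta>s (c - 1) - \<theta>s h) / (\<Prod>h\<in>{0..<c}. \<theta>s c - \<theta>s h)
       else if r = c + 1 then
         split2 p r * (\<Prod>h\<in>{r + 1..d}. \<theta>s r - \<theta>s h) / (\<Prod>h\<in>{r..d}. \<theta>s (r - 1) - \<theta>s h)
       else 0))"

definition matrix_D :: "nat \<Rightarrow> 'a::field param_array \<Rightarrow> 'a mat" where
  "matrix_D d p = mat (d + 1) (d + 1) (\<lambda>(r, c). if r = c then dual_eigval p r else 0)"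

definition tridiagonal_mat :: "'a::zero mat \<Rightarrow> bool" where
  "tridiagonal_mat A \<longleftrightarrow>
     (\<forall>i<dim_row A. \<forall>j<dim_col A. \<bar>int i - int j\<bar> > 1 \<longrightarrow> A $$ (i, j) = 0)"

definition TD_D_canonical :: "nat \<Rightarrow> 'a::field leonard_data \<Rightarrow> bool" where
  "TD_D_canonical d \<Phi> \<longleftrightarrow>
     op \<Phi> \<in> carrier_mat (d + 1) (d + 1) \<and> dual_op \<Phi> \<in> carrier_mat (d + 1) (d + 1) \<and>
     tridiagonal_mat (op \<Phi>) \<and> diagonal_mat (dual_op \<Phi>) \<and>
     (\<forall>i\<le>d. (\<Sum>j\<in>{0..d}. op \<Phi> $$ (i, j)) = eigenvalue_seq d \<Phi> 0) \<and>
     dual_op \<Phi> $$ (0, 0) = dual_eigenvalue_seq d \<Phi> 0"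

end

(*
Since A is tridiagonal, the diagonal matrix A* must list the dual eigenvalues in their
natural order, so E*_i is a diagonal matrix unit and U_i consists of the vectors supported
on {0..i} whose E_j-components vanish for j < i. As A is irreducible tridiagonal, shifting
by A - theta_i enlarges the support by one while killing one more component; hence a vector
in U_i is determined by its i-th entry.

Put u_i = prod_{h<i} (A - theta_h) e_0, which lies in U_i; comparing entries in
(A* - theta*_i) u_i = phi_i u_(i-1) and (A - theta_i) u_i = u_(i+1) expresses the diagonal
entries of A through the first split sequence. The row sum condition says that the all-ones
vector 1 lies in E_0 V. Then w_i = prod_{h<i} (A* - theta*_h) 1 satisfies
(A - theta_i) w_i = s_i w_(i-1), where s_i gives the superdiagonal entry, and the diagonal
entries obey the same recursion in s_i as in phi_i, so s_i is the first split sequence. For the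
second split sequence, prod_{h>k} (A* - theta*_h) 1 spans the k-th split space of the system
with E_0, ..., E_d reversed, and its defining relation is directly the subdiagonal entry.
*)
theory Submission
  imports Defs
begin

section \<open>Matrices and eigenvectors\<close>

lemma vec_eq_if_minus_zero:
  fixes v :: "'a::group_add vec"
  assumes "v \<in> carrier_vec n" "w \<in> carrier_vec n" "v - w = 0\<^sub>v n"
  shows "v = w"
proof (rule eq_vecI)
  fix i assume "i < dim_vec w"
  then have i: "i < n" using assms by simp
  have "(v - w) $ i = 0"
    unfolding assms(3) using i by simp
  then show "v $ i = w $ i"
    using assms(1,2) i by simp
qed (use assms in auto)

lemma zero_smult:
  fixes v :: "'a::field vec"
  assumes "v \<in> carrier_vec n"
  shows "0 \<cdot>\<^sub>v v = 0\<^sub>v n"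
  using assms by (intro eq_vecI) auto

lemma mult_mat_zero_vec:
  fixes M :: "'a::field mat"
  assumes "M \<in> carrier_mat n n"
  shows "M *\<^sub>v 0\<^sub>v n = 0\<^sub>v n"
  using assms by (intro eq_vecI) (auto simp: scalar_prod_def)

text \<open>The action of \<open>M - s I\<close> on a vector, without the scalar matrix, so that
  entries and coordinates can be computed directly; \<open>minus_smult_one_mult_vec\<close> links
  the two forms.\<close>

definition shifted :: "'a::field mat \<Rightarrow> 'a \<Rightarrow> 'a vec \<Rightarrow> 'a vec" where
  "shifted M s v = M *\<^sub>v v - s \<cdot>\<^sub>v v"

lemma smult_mat_one_mult_vec:
  fixes v :: "'a::field vec"
  assumes "v \<in> carrier_vec n"
  shows "(c \<cdot>\<^sub>m 1\<^sub>m n) *\<^sub>v v = c \<cdot>\<^sub>v v"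
proof (rule eq_vecI)
  fix i assume "i < dim_vec (c \<cdot>\<^sub>v v)"
  then have i: "i < n" using assms by simp
  then have "((c \<cdot>\<^sub>m 1\<^sub>m n) *\<^sub>v v) $ i = (\<Sum>j\<in>{0..<n}. (if i = j then c else 0) * v $ j)"
    using assms by (simp add: scalar_prod_def) (rule sum.cong, auto)
  also have "\<dots> = (\<Sum>j\<in>{0..<n}. if i = j then c * v $ j else 0)"
    by (rule sum.cong) auto
  finally show "((c \<cdot>\<^sub>m 1\<^sub>m n) *\<^sub>v v) $ i = (c \<cdot>\<^sub>v v) $ i"
    using i assms by simp
qed (use assms in simp)

lemma minus_smult_one_mult_vec:
  fixes M :: "'a::field mat"
  assumes "M \<in> carrier_mat n n" "v \<in> carrier_vec n"
  shows "(M - c \<cdot>\<^sub>m 1\<^sub>m n) *\<^sub>v v = shifted M c v"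
  using assms
  by (simp add: shifted_def minus_mult_distrib_mat_vec[of _ n n] smult_mat_one_mult_vec)

lemma mat_eqI_mult_vec:
  fixes M N :: "'a::field mat"
  assumes M: "M \<in> carrier_mat n n" and N: "N \<in> carrier_mat n n"
    and eq: "\<And>v. v \<in> carrier_vec n \<Longrightarrow> M *\<^sub>v v = N *\<^sub>v v"
  shows "M = N"
proof (rule eq_matI)
  have entry: "(K *\<^sub>v unit_vec n c) $ r = K $$ (r, c)"
    if "K \<in> carrier_mat n n" "r < n" "c < n" for K :: "'a mat" and r c
    using that by (simp add: scalar_prod_right_unit)
  fix r c assume "r < dim_row N" "c < dim_col N"
  then show "M $$ (r, c) = N $$ (r, c)"
    using entry[OF M, of r c] entry[OF N, of r c] eq[of "unit_vec n c"] N by simp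
qed (use M N in auto)

text \<open>This is \<open>M X = X diag(m)\<close> applied to a vector. \<open>X\<close> may be any
  matrix of eigenvectors: in \<open>eigenbasis_exists\<close> the lemma serves to prove that
  \<open>X\<close> is invertible.\<close>

lemma mult_eigenbasis:
  fixes M X :: "'a::field mat"
  assumes M: "M \<in> carrier_mat n n" and X: "X \<in> carrier_mat n n"
    and eig: "\<And>k. k < n \<Longrightarrow> M *\<^sub>v col X k = m k \<cdot>\<^sub>v col X k"
    and a: "a \<in> carrier_vec n"
  shows "M *\<^sub>v (X *\<^sub>v a) = X *\<^sub>v vec n (\<lambda>k. m k * a $ k)"
proof -
  have MX: "(M * X) $$ (i, j) = m j * X $$ (i, j)" if "i < n" "j < n" for i j
    using arg_cong[OF eig[OF that(2)], of "\<lambda>v. v $ i"] that M X by simp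
  define P where "P = M * X"
  have P: "P \<in> carrier_mat n n"
    using M X by (simp add: P_def)
  have "M *\<^sub>v (X *\<^sub>v a) = P *\<^sub>v a"
    using M X a by (simp add: P_def)
  also have "\<dots> = X *\<^sub>v vec n (\<lambda>k. m k * a $ k)"
  proof (rule eq_vecI)
    fix i assume "i < dim_vec (X *\<^sub>v vec n (\<lambda>k. m k * a $ k))"
    then have i: "i < n" using X by simp
    have "(P *\<^sub>v a) $ i = (\<Sum>j\<in>{0..<n}. P $$ (i, j) * a $ j)"
      using i P a by (simp add: scalar_prod_def)
    also have "\<dots> = (\<Sum>j\<in>{0..<n}. X $$ (i, j) * (m j * a $ j))"
      using i by (intro sum.cong) (simp_all add: MX P_def del: index_mult_mat(1))
    finally show "(P *\<^sub>v a) $ i = (X *\<^sub>v vec n (\<lambda>k. m k * a $ k)) $ i"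
      using i X by (simp add: scalar_prod_def)
  qed (use P X in simp)
  finally show ?thesis .
qed

section \<open>Primitive idempotents and bases of eigenvectors\<close>

lemma foldr_mult_mat_eigenvector:
  fixes F :: "'b \<Rightarrow> 'a::field mat"
  assumes "\<And>j. j \<in> set js \<Longrightarrow> F j \<in> carrier_mat n n"
    and "\<And>j. j \<in> set js \<Longrightarrow> F j *\<^sub>v x = c j \<cdot>\<^sub>v x"
    and x: "x \<in> carrier_vec n"
  shows "foldr (*) (map F js) (1\<^sub>m n) \<in> carrier_mat n n \<and>
    foldr (*) (map F js) (1\<^sub>m n) *\<^sub>v x = prod_list (map c js) \<cdot>\<^sub>v x"
  using assms(1,2)
proof (induction js)
  case Nil
  then show ?case using x by simp
next
  case (Cons j js)
  let ?P = "foldr (*) (map F js) (1\<^sub>m n)"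
  have Fj: "F j \<in> carrier_mat n n" "F j *\<^sub>v x = c j \<cdot>\<^sub>v x"
    using Cons.prems by auto
  have P: "?P \<in> carrier_mat n n" "?P *\<^sub>v x = prod_list (map c js) \<cdot>\<^sub>v x"
    using Cons by auto
  have "(F j * ?P) *\<^sub>v x = prod_list (map c js) \<cdot>\<^sub>v (F j *\<^sub>v x)"
    using Fj(1) P x mult_mat_vec[OF Fj(1) x] by simp
  then show ?case
    using Fj P by (simp add: smult_smult_assoc mult.commute)
qed

text \<open>The idempotent is the Lagrange polynomial that is 1 at \<open>\<theta> i\<close> and 0
  at the other eigenvalues, evaluated at \<open>A\<close>; on an eigenvector it acts by its value at
  \<open>\<theta> k\<close>.\<close>

lemma primitive_idempotent_eigenvector:
  fixes A :: "'a::field mat"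
  assumes A: "A \<in> carrier_mat (d + 1) (d + 1)" and x: "x \<in> carrier_vec (d + 1)"
    and inj: "inj_on \<theta> {0..d}" and i: "i \<le> d" and k: "k \<le> d"
    and eig: "A *\<^sub>v x = \<theta> k \<cdot>\<^sub>v x"
  shows "primitive_idempotent d A \<theta> i *\<^sub>v x = (if k = i then 1 else 0) \<cdot>\<^sub>v x"
proof -
  let ?F = "\<lambda>j. (1 / (\<theta> i - \<theta> j)) \<cdot>\<^sub>m (A - \<theta> j \<cdot>\<^sub>m 1\<^sub>m (d + 1))"
  let ?c = "\<lambda>j. (\<theta> k - \<theta> j) / (\<theta> i - \<theta> j)"
  let ?js = "filter (\<lambda>j. j \<noteq> i) [0..<d + 1]"
  have F: "?F j \<in> carrier_mat (d + 1) (d + 1)" for j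
    using A by auto
  have Fx: "?F j *\<^sub>v x = ?c j \<cdot>\<^sub>v x" for j
  proof (rule eq_vecI)
    fix r assume "r < dim_vec (?c j \<cdot>\<^sub>v x)"
    then have r: "r < d + 1" using x by simp
    have "((A - \<theta> j \<cdot>\<^sub>m 1\<^sub>m (d + 1)) *\<^sub>v x) $ r = (\<theta> k - \<theta> j) * x $ r"
      using r x by (simp only: minus_smult_one_mult_vec[OF A x])
        (simp add: shifted_def eig algebra_simps)
    then show "(?F j *\<^sub>v x) $ r = (?c j \<cdot>\<^sub>v x) $ r"
      using r x A by (simp add: scalar_prod_def sum_distrib_left mult.assoc sum_divide_distrib[symmetric])
  qed (use A x in simp)
  have fold: "primitive_idempotent d A \<theta> i *\<^sub>v x = prod_list (map ?c ?js) \<cdot>\<^sub>v x"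
    unfolding primitive_idempotent_def
    by (rule conjunct2[OF foldr_mult_mat_eigenvector[OF F Fx x]])
  have "prod_list (map ?c ?js) = (if k = i then 1 else 0)"
  proof (cases "k = i")
    case True
    have prod1: "prod_list ys = 1" if "\<forall>y\<in>set ys. y = 1" for ys :: "'a list"
      using that by (induction ys) auto
    have "\<forall>y\<in>set (map ?c ?js). y = 1"
    proof
      fix y assume "y \<in> set (map ?c ?js)"
      then obtain j where "j \<in> set ?js" "y = ?c j"
        unfolding set_map by blast
      then have "y = ?c j" "j \<le> d" "j \<noteq> i"
        unfolding set_filter by auto
      moreover from this have "\<theta> i - \<theta> j \<noteq> 0"
        using inj i by (auto dest: inj_onD)
      ultimately show "y = 1" using True by simp
    qed
    then have "prod_list (map ?c ?js) = 1"
      by (rule prod1)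
    then show ?thesis using True by simp
  next
    case False
    then have "k \<in> set ?js"
      using k by (simp del: upt_Suc)
    then have "0 \<in> set (map ?c ?js)"
      unfolding set_map by (rule rev_image_eqI) simp
    then show ?thesis using False by (simp add: prod_list_zero_iff)
  qed
  then show ?thesis
    using fold by simp
qed

lemma primitive_idempotent_carrier:
  fixes A :: "'a::field mat"
  assumes "A \<in> carrier_mat (d + 1) (d + 1)"
  shows "primitive_idempotent d A \<theta> i \<in> carrier_mat (d + 1) (d + 1)"
proof -
  have "foldr (*) Ms (1\<^sub>m (d + 1)) \<in> carrier_mat (d + 1) (d + 1)"
    if "set Ms \<subseteq> carrier_mat (d + 1) (d + 1)" for Ms :: "'a mat list"
    using that by (induction Ms) auto
  note foldr_carrier = this
  show ?thesis
    unfolding primitive_idempotent_def by (rule foldr_carrier) (use assms in \<open>auto simp del: upt_Suc\<close>)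
qed

text \<open>Eigenvectors for distinct eigenvalues are independent: applying the k-th idempotent to a
  relation \<open>X a = 0\<close> leaves only its k-th term. So \<open>X\<close> is invertible, with
  inverse \<open>Y\<close>.\<close>

lemma eigenbasis_exists:
  fixes A :: "'a::field mat"
  assumes A: "A \<in> carrier_mat (d + 1) (d + 1)" and ord: "eigenvalue_ordering d A \<theta>"
  obtains X Y where "X \<in> carrier_mat (d + 1) (d + 1)" "Y \<in> carrier_mat (d + 1) (d + 1)"
    "X * Y = 1\<^sub>m (d + 1)" "Y * X = 1\<^sub>m (d + 1)"
    "\<And>k. k \<le> d \<Longrightarrow> A *\<^sub>v col X k = \<theta> k \<cdot>\<^sub>v col X k"
proof -
  let ?n = "d + 1"
  have inj: "inj_on \<theta> {0..d}" and img: "\<theta> ` {0..d} = {t. eigenvalue A t}"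
    using ord by (auto simp: eigenvalue_ordering_def bij_betw_def)
  have "\<forall>k\<in>{0..d}. \<exists>x. eigenvector A x (\<theta> k)"
    using img by (auto simp: eigenvalue_def)
  then obtain x where x: "\<And>k. k \<le> d \<Longrightarrow> eigenvector A (x k) (\<theta> k)"
    by (metis atLeastAtMost_iff le0)
  define X where "X = mat ?n ?n (\<lambda>(i, j). x j $ i)"
  have X: "X \<in> carrier_mat ?n ?n" by (simp add: X_def)
  have xc: "x k \<in> carrier_vec ?n" "x k \<noteq> 0\<^sub>v ?n" "A *\<^sub>v x k = \<theta> k \<cdot>\<^sub>v x k" if "k \<le> d" for k
    using x[OF that] A by (auto simp: eigenvector_def)
  have colX: "col X k = x k" if "k \<le> d" for k
    using xc[OF that] that by (intro eq_vecI) (auto simp: X_def)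
  have "det X \<noteq> 0"
  proof
    assume "det X = 0"
    then obtain a where a: "a \<in> carrier_vec ?n" "a \<noteq> 0\<^sub>v ?n" "X *\<^sub>v a = 0\<^sub>v ?n"
      using det_0_iff_vec_prod_zero_field[OF X] by blast
    have "a $ k = 0" if k: "k \<le> d" for k
    proof -
      let ?E = "primitive_idempotent d A \<theta> k"
      have E: "?E \<in> carrier_mat ?n ?n" by (rule primitive_idempotent_carrier[OF A])
      have EXa: "?E *\<^sub>v (X *\<^sub>v a) = X *\<^sub>v vec ?n (\<lambda>j. (if j = k then 1 else 0) * a $ j)"
      proof (rule mult_eigenbasis[OF E X _ a(1)])
        fix j assume "j < ?n"
        then show "?E *\<^sub>v col X j = (if j = k then 1 else 0) \<cdot>\<^sub>v col X j"
          using primitive_idempotent_eigenvector[OF A xc(1) inj k _ xc(3), of j] colX[of j] by simp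
      qed
      have "X *\<^sub>v vec ?n (\<lambda>j. (if j = k then 1 else 0) * a $ j) = 0\<^sub>v ?n"
        unfolding EXa[symmetric] a(3) by (rule mult_mat_zero_vec[OF E])
      \<comment> \<open>A nonzero entry of the k-th eigenvector; the surviving term of the relation
        is read off there.\<close>
      moreover obtain i where i: "i < ?n" "x k $ i \<noteq> 0"
        using xc(1,2)[OF k] by (metis carrier_vecD eq_vecI index_zero_vec)
      moreover have "(X *\<^sub>v vec ?n (\<lambda>j. (if j = k then 1 else 0) * a $ j)) $ i = x k $ i * a $ k"
      proof -
        have "(X *\<^sub>v vec ?n (\<lambda>j. (if j = k then 1 else 0) * a $ j)) $ i =
          (\<Sum>j\<in>{0..<?n}. x j $ i * ((if j = k then 1 else 0) * a $ j))"
        using i by (simp add: X_def scalar_prod_def del: sum.op_ivl_Suc)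
        also have "\<dots> = (\<Sum>j\<in>{0..<?n}. if j = k then x k $ i * a $ k else 0)"
          by (rule sum.cong) auto
        finally show ?thesis
          using k by (simp del: sum.op_ivl_Suc)
      qed
      ultimately show ?thesis by simp
    qed
    then have "a = 0\<^sub>v ?n"
      using a(1) by (intro eq_vecI) auto
    then show False using a(2) by simp
  qed
  then have "X \<in> Units (ring_mat TYPE('a) ?n ())"
    by (rule det_non_zero_imp_unit[OF X])
  then obtain Y where "Y \<in> carrier_mat ?n ?n" "X * Y = 1\<^sub>m ?n" "Y * X = 1\<^sub>m ?n"
    by (auto simp: Units_def ring_mat_simps)
  then show thesis
    using that[OF X] by (simp add: colX xc(3))
qed

section \<open>Coordinates\<close>

text \<open>An abstract coordinate system, so that the same lemmas serve for the standard entries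
  and for the components along eigenvectors of \<open>A\<close>.\<close>

locale linear_coords =
  fixes d :: nat and \<beta> :: "'a::field vec \<Rightarrow> nat \<Rightarrow> 'a"
  assumes coord_add: "v \<in> carrier_vec (d + 1) \<Longrightarrow> w \<in> carrier_vec (d + 1) \<Longrightarrow> j \<le> d \<Longrightarrow>
          \<beta> (v + w) j = \<beta> v j + \<beta> w j"
    and coord_smult: "v \<in> carrier_vec (d + 1) \<Longrightarrow> j \<le> d \<Longrightarrow> \<beta> (s \<cdot>\<^sub>v v) j = s * \<beta> v j"
    and coord_inj: "v \<in> carrier_vec (d + 1) \<Longrightarrow> (\<And>j. j \<le> d \<Longrightarrow> \<beta> v j = 0) \<Longrightarrow> v = 0\<^sub>v (d + 1)"
begin

lemma coord_minus:
  assumes "v \<in> carrier_vec (d + 1)" "w \<in> carrier_vec (d + 1)" "j \<le> d"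
  shows "\<beta> (v - w) j = \<beta> v j - \<beta> w j"
proof -
  have "v - w = v + (-1) \<cdot>\<^sub>v w"
    using assms by auto
  then show ?thesis
    using assms by (simp add: coord_add coord_smult)
qed

lemma coord_zero: "j \<le> d \<Longrightarrow> \<beta> (0\<^sub>v (d + 1)) j = 0"
  using coord_smult[of "0\<^sub>v (d + 1)" j 0] zero_smult[of "0\<^sub>v (d + 1) :: 'a vec" "d + 1"] by simp

lemma coords_eqI:
  assumes v: "v \<in> carrier_vec (d + 1)" and w: "w \<in> carrier_vec (d + 1)"
    and eq: "\<And>j. j \<le> d \<Longrightarrow> \<beta> v j = \<beta> w j"
  shows "v = w"
  using v w by (intro vec_eq_if_minus_zero[OF v w], intro coord_inj)
    (simp_all add: coord_minus eq)

text \<open>The matrix \<open>M\<close> is carried along to cover two uses: the identity in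
  \<open>coord_finsum_E\<close> and the dual operator in \<open>coord_tridiagonal\<close>.\<close>

lemma coord_mult_finsum:
  assumes M: "M \<in> carrier_mat (d + 1) (d + 1)" and k: "k \<le> d"
    and J: "finite J" "f \<in> J \<rightarrow> carrier_vec (d + 1)"
  shows "\<beta> (M *\<^sub>v finsum_vec TYPE('a) (d + 1) f J) k = (\<Sum>j\<in>J. \<beta> (M *\<^sub>v f j) k)"
  using J
proof (induction J rule: finite_induct)
  case empty
  show ?case
    unfolding finsum_vec_empty mult_mat_zero_vec[OF M] using coord_zero[OF k] by simp
next
  case (insert j J)
  have f: "f j \<in> carrier_vec (d + 1)" "f \<in> J \<rightarrow> carrier_vec (d + 1)"
    using insert.prems by auto
  then have c: "finsum_vec TYPE('a) (d + 1) f J \<in> carrier_vec (d + 1)"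
    by (intro finsum_vec_closed)
  have "finsum_vec TYPE('a) (d + 1) f (insert j J) = f j + finsum_vec TYPE('a) (d + 1) f J"
    using insert.hyps f by (intro finsum_vec_insert) auto
  then have "M *\<^sub>v finsum_vec TYPE('a) (d + 1) f (insert j J) =
      M *\<^sub>v f j + M *\<^sub>v finsum_vec TYPE('a) (d + 1) f J"
    using mult_add_distrib_mat_vec[OF M f(1) c] by simp
  then show ?case
    using insert.hyps insert.IH[OF f(2)] M f(1) c k by (simp add: coord_add)
qed

end

section \<open>Coordinates whose projections are the given idempotents\<close>

locale idempotent_coords = linear_coords d \<beta>
  for d :: nat and \<beta> :: "'a::field vec \<Rightarrow> nat \<Rightarrow> 'a" +
  fixes E :: "nat \<Rightarrow> 'a mat"
  assumes E_carrier: "i \<le> d \<Longrightarrow> E i \<in> carrier_mat (d + 1) (d + 1)"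
    and coord_E: "v \<in> carrier_vec (d + 1) \<Longrightarrow> i \<le> d \<Longrightarrow> j \<le> d \<Longrightarrow>
          \<beta> (E i *\<^sub>v v) j = (if i = j then \<beta> v j else 0)"
begin

lemma finsum_E_carrier:
  assumes J: "J \<subseteq> {0..d}" and v: "\<And>j. j \<in> J \<Longrightarrow> v j \<in> carrier_vec (d + 1)"
  shows "(\<lambda>j. E j *\<^sub>v v j) \<in> J \<rightarrow> carrier_vec (d + 1)"
    and "finsum_vec TYPE('a) (d + 1) (\<lambda>j. E j *\<^sub>v v j) J \<in> carrier_vec (d + 1)"
proof -
  show c: "(\<lambda>j. E j *\<^sub>v v j) \<in> J \<rightarrow> carrier_vec (d + 1)"
  proof
    fix j assume "j \<in> J"
    then show "E j *\<^sub>v v j \<in> carrier_vec (d + 1)"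
      using J v[of j] mult_mat_vec_carrier[OF E_carrier] by auto
  qed
  then show "finsum_vec TYPE('a) (d + 1) (\<lambda>j. E j *\<^sub>v v j) J \<in> carrier_vec (d + 1)"
    by (rule finsum_vec_closed)
qed

lemma coord_finsum_E:
  assumes J: "J \<subseteq> {0..d}" and v: "\<And>j. j \<in> J \<Longrightarrow> v j \<in> carrier_vec (d + 1)" and k: "k \<le> d"
  shows "\<beta> (finsum_vec TYPE('a) (d + 1) (\<lambda>j. E j *\<^sub>v v j) J) k = (if k \<in> J then \<beta> (v k) k else 0)"
proof -
  let ?s = "finsum_vec TYPE('a) (d + 1) (\<lambda>j. E j *\<^sub>v v j) J"
  have fin: "finite J" using J finite_subset by blast
  note c = finsum_E_carrier(1)[of J v, OF J v] and s = finsum_E_carrier(2)[of J v, OF J v]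
  have "\<beta> ?s k = \<beta> (1\<^sub>m (d + 1) *\<^sub>v ?s) k"
    using s by (metis one_mult_mat_vec)
  also have "\<dots> = (\<Sum>j\<in>J. \<beta> (1\<^sub>m (d + 1) *\<^sub>v (E j *\<^sub>v v j)) k)"
    by (rule coord_mult_finsum[OF one_carrier_mat k fin c])
  also have "\<dots> = (\<Sum>j\<in>J. if j = k then \<beta> (v k) k else 0)"
  proof (rule sum.cong[OF refl])
    fix j assume j: "j \<in> J"
    then have "E j *\<^sub>v v j \<in> carrier_vec (d + 1)" using c by auto
    then have "1\<^sub>m (d + 1) *\<^sub>v (E j *\<^sub>v v j) = E j *\<^sub>v v j" by (rule one_mult_mat_vec)
    then show "\<beta> (1\<^sub>m (d + 1) *\<^sub>v (E j *\<^sub>v v j)) k = (if j = k then \<beta> (v k) k else 0)"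
      using coord_E[OF v[OF j], of j k] J j k by auto
  qed
  also have "\<dots> = (if k \<in> J then \<beta> (v k) k else 0)"
    using fin by simp
  finally show "\<beta> ?s k = (if k \<in> J then \<beta> (v k) k else 0)" .
qed

text \<open>Turns a sum of idempotent images into vanishing conditions, so that the intersection
  defining a split space becomes a conjunction. Both inclusions compare coordinates through
  \<open>coord_finsum_E\<close>.\<close>

lemma idem_image_sum_eq:
  assumes J: "J \<subseteq> {0..d}"
  shows "idem_image_sum d E J = {v \<in> carrier_vec (d + 1). \<forall>j\<le>d. j \<notin> J \<longrightarrow> \<beta> v j = 0}"
proof (intro equalityI subsetI)
  fix w assume "w \<in> idem_image_sum d E J"
  then obtain v where "w = finsum_vec TYPE('a) (d + 1) (\<lambda>j. E j *\<^sub>v v j) J"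
    "\<forall>j\<in>J. v j \<in> carrier_vec (d + 1)"
    by (auto simp: idem_image_sum_def)
  then show "w \<in> {v \<in> carrier_vec (d + 1). \<forall>j\<le>d. j \<notin> J \<longrightarrow> \<beta> v j = 0}"
    using coord_finsum_E[OF J, of v] finsum_E_carrier(2)[OF J, of v] by auto
next
  fix w assume w: "w \<in> {v \<in> carrier_vec (d + 1). \<forall>j\<le>d. j \<notin> J \<longrightarrow> \<beta> v j = 0}"
  \<comment> \<open>\<open>w\<close> itself serves as the vector in every summand, since
    \<open>E j\<close> keeps exactly its coordinate \<open>j\<close>.\<close>
  have "w = finsum_vec TYPE('a) (d + 1) (\<lambda>j. E j *\<^sub>v w) J"
    using w coord_finsum_E[OF J, of "\<lambda>_. w"] finsum_E_carrier(2)[OF J, of "\<lambda>_. w"]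
    by (intro coords_eqI) auto
  then show "w \<in> idem_image_sum d E J"
    using w unfolding idem_image_sum_def by (intro CollectI exI[of _ "\<lambda>_. w"]) auto
qed

text \<open>The relations \<open>E i * D * E j = 0\<close> say that coordinate \<open>i\<close> of
  \<open>D v\<close> depends only on the neighbouring coordinates of \<open>v\<close>. In the
  expansion of \<open>v\<close> as the sum of the \<open>E j v\<close>, a far term dies by the
  relation and a near term because \<open>E j v\<close> is already zero.\<close>

lemma coord_tridiagonal:
  assumes D: "D \<in> carrier_mat (d + 1) (d + 1)"
    and zero: "\<And>i j. i \<le> d \<Longrightarrow> j \<le> d \<Longrightarrow> \<bar>int i - int j\<bar> > 1 \<Longrightarrow>
      E i * D * E j = 0\<^sub>m (d + 1) (d + 1)"
    and v: "v \<in> carrier_vec (d + 1)" and i: "i \<le> d"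
    and near: "\<And>j. j \<le> d \<Longrightarrow> j \<le> i + 1 \<Longrightarrow> i \<le> j + 1 \<Longrightarrow> \<beta> v j = 0"
  shows "\<beta> (D *\<^sub>v v) i = 0"
proof -
  have vE: "v = finsum_vec TYPE('a) (d + 1) (\<lambda>j. E j *\<^sub>v v) {0..d}"
    using v coord_finsum_E[of "{0..d}" "\<lambda>_. v"] finsum_E_carrier(2)[of "{0..d}" "\<lambda>_. v"]
    by (intro coords_eqI) simp_all
  have Ev: "E j *\<^sub>v v \<in> carrier_vec (d + 1)" if "j \<le> d" for j
    using E_carrier[OF that] v by simp
  have "\<beta> (D *\<^sub>v v) i = \<beta> (D *\<^sub>v finsum_vec TYPE('a) (d + 1) (\<lambda>j. E j *\<^sub>v v) {0..d}) i"
    using vE by simp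
  also have "\<dots> = (\<Sum>j\<in>{0..d}. \<beta> (D *\<^sub>v (E j *\<^sub>v v)) i)"
    by (rule coord_mult_finsum[OF D i]) (use Ev in auto)
  also have "\<dots> = 0"
  proof (intro sum.neutral ballI)
    fix j assume "j \<in> {0..d}"
    then have j: "j \<le> d" by simp
    have DEv: "D *\<^sub>v (E j *\<^sub>v v) \<in> carrier_vec (d + 1)"
      using D Ev[OF j] by simp
    show "\<beta> (D *\<^sub>v (E j *\<^sub>v v)) i = 0"
    proof (cases "\<bar>int i - int j\<bar> > 1")
      case True
      have ED: "E i * D \<in> carrier_mat (d + 1) (d + 1)"
        using E_carrier[OF i] D by (rule mult_carrier_mat)
      have "E i *\<^sub>v (D *\<^sub>v (E j *\<^sub>v v)) = (E i * D) *\<^sub>v (E j *\<^sub>v v)"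
        by (rule assoc_mult_mat_vec[OF E_carrier[OF i] D Ev[OF j], symmetric])
      also have "\<dots> = (E i * D * E j) *\<^sub>v v"
        by (rule assoc_mult_mat_vec[OF ED E_carrier[OF j] v, symmetric])
      also have "\<dots> = 0\<^sub>v (d + 1)"
        using zero[OF i j True] v by auto
      finally have "\<beta> (E i *\<^sub>v (D *\<^sub>v (E j *\<^sub>v v))) i = 0"
        using coord_zero[OF i] by simp
      \<comment> \<open>Applying \<open>E i\<close> leaves coordinate \<open>i\<close> unchanged, so
        it vanishes before \<open>E i\<close> as well.\<close>
      then show ?thesis
        using coord_E[OF DEv i i] by simp
    next
      case False
      then have "\<beta> v j = 0"
        using near[OF j] by auto
      then have "E j *\<^sub>v v = 0\<^sub>v (d + 1)"
        using coord_E[OF v j] by (intro coord_inj Ev[OF j]) auto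
      then have "D *\<^sub>v (E j *\<^sub>v v) = 0\<^sub>v (d + 1)"
        using mult_mat_zero_vec[OF D] by simp
      then show ?thesis
        using coord_zero[OF i] by simp
    qed
  qed
  finally show ?thesis .
qed

end

text \<open>\<beta> gives the coefficients in an eigenbasis \<open>X\<close> of \<open>A\<close>,
  that is, the inverse \<open>Y\<close> applied to the vector. The matrix \<open>A\<close> and all
  the idempotents have the columns of \<open>X\<close> as eigenvectors, hence are diagonal in these
  coordinates.\<close>

lemma idempotent_coords_exists:
  fixes A :: "'a::field mat"
  assumes A: "A \<in> carrier_mat (d + 1) (d + 1)" and assoc: "associated_eigenvalues d A E \<theta>"
  obtains \<beta> where "idempotent_coords d \<beta> E"
    "\<And>v k. v \<in> carrier_vec (d + 1) \<Longrightarrow> k \<le> d \<Longrightarrow> \<beta> (A *\<^sub>v v) k = \<theta> k * \<beta> v k"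
proof -
  let ?n = "d + 1"
  have ord: "eigenvalue_ordering d A \<theta>" and inj: "inj_on \<theta> {0..d}"
    and E: "\<And>i. i \<le> d \<Longrightarrow> E i = primitive_idempotent d A \<theta> i"
    using assoc by (auto simp: associated_eigenvalues_def eigenvalue_ordering_def bij_betw_def)
  obtain X Y where X: "X \<in> carrier_mat ?n ?n" and Y: "Y \<in> carrier_mat ?n ?n"
    and XY: "X * Y = 1\<^sub>m ?n" and YX: "Y * X = 1\<^sub>m ?n"
    and eig: "\<And>k. k \<le> d \<Longrightarrow> A *\<^sub>v col X k = \<theta> k \<cdot>\<^sub>v col X k"
    by (rule eigenbasis_exists[OF A ord]) (rule that)
  define \<beta> where "\<beta> v k = (Y *\<^sub>v v) $ k" for v k
  have XYv: "X *\<^sub>v (Y *\<^sub>v v) = v" if "v \<in> carrier_vec ?n" for v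
    using assoc_mult_mat_vec[OF X Y that] one_mult_mat_vec[OF that] XY by metis
  have YXv: "Y *\<^sub>v (X *\<^sub>v v) = v" if "v \<in> carrier_vec ?n" for v
    using assoc_mult_mat_vec[OF Y X that] one_mult_mat_vec[OF that] YX by metis
  have diag: "\<beta> (M *\<^sub>v v) k = m k * \<beta> v k"
    if M: "M \<in> carrier_mat ?n ?n" and m: "\<And>k. k < ?n \<Longrightarrow> M *\<^sub>v col X k = m k \<cdot>\<^sub>v col X k"
      and v: "v \<in> carrier_vec ?n" and k: "k \<le> d" for M m v k
  proof -
    have Yv: "Y *\<^sub>v v \<in> carrier_vec ?n" using Y v by simp
    have "M *\<^sub>v v = X *\<^sub>v vec ?n (\<lambda>k. m k * (Y *\<^sub>v v) $ k)"
      using mult_eigenbasis[OF M X m Yv] XYv[OF v] by simp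
    then have "Y *\<^sub>v (M *\<^sub>v v) = vec ?n (\<lambda>k. m k * (Y *\<^sub>v v) $ k)"
      using YXv by simp
    then show ?thesis
      unfolding \<beta>_def using k by simp
  qed
  have Ec: "E i \<in> carrier_mat ?n ?n" if "i \<le> d" for i
    using E[OF that] primitive_idempotent_carrier[OF A] by simp
  have colc: "col X k \<in> carrier_vec ?n" for k
    using col_dim[of X k] X by simp
  have Ecol: "E i *\<^sub>v col X k = (if k = i then 1 else 0) \<cdot>\<^sub>v col X k" if "i \<le> d" "k < ?n" for i k
    using that E primitive_idempotent_eigenvector[OF A colc inj that(1) _ eig, of k] by simp
  have "idempotent_coords d \<beta> E"
  proof
    fix v :: "'a vec" assume v: "v \<in> carrier_vec ?n" and z: "\<And>j. j \<le> d \<Longrightarrow> \<beta> v j = 0"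
    then have "Y *\<^sub>v v = 0\<^sub>v ?n"
      using Y by (intro eq_vecI) (auto simp: \<beta>_def simp del: index_mult_mat_vec)
    then show "v = 0\<^sub>v ?n"
      using XYv[OF v] mult_mat_zero_vec[OF X] by simp
  next
    fix v :: "'a vec" and i j assume "v \<in> carrier_vec ?n" "i \<le> d" "j \<le> d"
    then show "\<beta> (E i *\<^sub>v v) j = (if i = j then \<beta> v j else 0)"
      using diag[OF Ec Ecol, of i v j] by simp
  next
    fix v w :: "'a vec" and j assume "v \<in> carrier_vec ?n" "w \<in> carrier_vec ?n" "j \<le> d"
    then show "\<beta> (v + w) j = \<beta> v j + \<beta> w j"
      unfolding \<beta>_def using Y by (simp add: mult_add_distrib_mat_vec[OF Y] del: index_mult_mat_vec)
  next
    fix v :: "'a vec" and s j assume "v \<in> carrier_vec ?n" "j \<le> d"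
    then show "\<beta> (s \<cdot>\<^sub>v v) j = s * \<beta> v j"
      unfolding \<beta>_def using Y by (simp add: mult_mat_vec[OF Y] del: index_mult_mat_vec)
  qed (rule Ec)
  moreover have "\<beta> (A *\<^sub>v v) k = \<theta> k * \<beta> v k" if "v \<in> carrier_vec ?n" "k \<le> d" for v k
    by (rule diag[OF A _ that]) (simp add: eig)
  ultimately show thesis
    by (rule that)
qed

text \<open>Reversal changes the order of the factors in \<open>primitive_idempotent\<close>, so the
  matrices are not equal by definition; they agree because they act alike on an eigenbasis.\<close>

lemma associated_eigenvalues_rev:
  fixes A :: "'a::field mat"
  assumes A: "A \<in> carrier_mat (d + 1) (d + 1)" and assoc: "associated_eigenvalues d A E \<theta>"
  shows "associated_eigenvalues d A (\<lambda>i. E (d - i)) (\<lambda>i. \<theta> (d - i))"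
proof -
  let ?n = "d + 1" and ?\<theta> = "\<lambda>i. \<theta> (d - i)"
  have ord: "eigenvalue_ordering d A \<theta>" and inj: "inj_on \<theta> {0..d}"
    and E: "\<And>i. i \<le> d \<Longrightarrow> E i = primitive_idempotent d A \<theta> i"
    using assoc by (auto simp: associated_eigenvalues_def eigenvalue_ordering_def bij_betw_def)
  have "bij_betw (\<lambda>i. d - i) {0..d} {0..d}"
    by (rule bij_betw_byWitness[where f' = "\<lambda>i. d - i"]) auto
  then have ord': "eigenvalue_ordering d A ?\<theta>"
    using bij_betw_trans[of "\<lambda>i. d - i" "{0..d}" "{0..d}" \<theta>] ord
    by (auto simp: eigenvalue_ordering_def comp_def)
  then have inj': "inj_on ?\<theta> {0..d}"
    by (auto simp: eigenvalue_ordering_def bij_betw_def)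
  obtain X Y where X: "X \<in> carrier_mat ?n ?n" and Y: "Y \<in> carrier_mat ?n ?n"
    and XY: "X * Y = 1\<^sub>m ?n" and "Y * X = 1\<^sub>m ?n"
    and eig: "\<And>k. k \<le> d \<Longrightarrow> A *\<^sub>v col X k = \<theta> k \<cdot>\<^sub>v col X k"
    by (rule eigenbasis_exists[OF A ord]) (rule that)
  have colc: "col X k \<in> carrier_vec ?n" for k
    using col_dim[of X k] X by simp
  have "E (d - i) = primitive_idempotent d A ?\<theta> i" if i: "i \<le> d" for i
  proof (rule mat_eqI_mult_vec)
    show c: "E (d - i) \<in> carrier_mat ?n ?n" "primitive_idempotent d A ?\<theta> i \<in> carrier_mat ?n ?n"
      using E[of "d - i"] primitive_idempotent_carrier[OF A] by simp_all
    fix v :: "'a vec" assume v: "v \<in> carrier_vec ?n"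
    define m :: "nat \<Rightarrow> 'a" where "m k = (if k = d - i then 1 else 0)" for k
    have 1: "E (d - i) *\<^sub>v col X k = m k \<cdot>\<^sub>v col X k" if "k < ?n" for k
      using that primitive_idempotent_eigenvector[OF A colc inj _ _ eig, of "d - i" k]
      by (simp add: E m_def)
    have 2: "primitive_idempotent d A ?\<theta> i *\<^sub>v col X k = m k \<cdot>\<^sub>v col X k" if "k < ?n" for k
    proof -
      have "A *\<^sub>v col X k = ?\<theta> (d - k) \<cdot>\<^sub>v col X k"
        using eig[of k] that by simp
      then have "primitive_idempotent d A ?\<theta> i *\<^sub>v col X k =
          (if d - k = i then 1 else 0) \<cdot>\<^sub>v col X k"
        by (intro primitive_idempotent_eigenvector[OF A colc inj' i]) simp_all
      moreover have "(d - k = i) = (k = d - i)"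
        using i that by linarith
      ultimately show ?thesis
        by (simp add: m_def)
    qed
    have Yv: "Y *\<^sub>v v \<in> carrier_vec ?n" using Y v by simp
    have XYv: "X *\<^sub>v (Y *\<^sub>v v) = v"
      using assoc_mult_mat_vec[OF X Y v] one_mult_mat_vec[OF v] XY by metis
    show "E (d - i) *\<^sub>v v = primitive_idempotent d A ?\<theta> i *\<^sub>v v"
      using mult_eigenbasis[OF c(1) X 1 Yv] mult_eigenbasis[OF c(2) X 2 Yv]
      by (simp only: XYv)
  qed
  then show ?thesis
    using ord' by (simp add: associated_eigenvalues_def)
qed

text \<open>An eigenvector for \<open>\<theta>' j\<close> is fixed by \<open>E' j\<close>, which
  equals \<open>E i\<close>, while \<open>E i\<close> kills the eigenvectors for every eigenvalue
  other than \<open>\<theta> i\<close>. This pins down values of eigenvalue sequences that were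
  obtained by choice.\<close>

lemma associated_eigenvalue_unique:
  fixes A :: "'a::field mat"
  assumes A: "A \<in> carrier_mat (d + 1) (d + 1)"
    and assoc: "associated_eigenvalues d A E \<theta>" "associated_eigenvalues d A E' \<theta>'"
    and ij: "i \<le> d" "j \<le> d" "E i = E' j"
  shows "\<theta> i = \<theta>' j"
proof -
  have img: "\<theta> ` {0..d} = \<theta>' ` {0..d}" "\<theta>' j \<in> {t. eigenvalue A t}"
    and inj: "inj_on \<theta> {0..d}" "inj_on \<theta>' {0..d}"
    and E: "E i = primitive_idempotent d A \<theta> i" "E' j = primitive_idempotent d A \<theta>' j"
    using assoc ij by (auto simp: associated_eigenvalues_def eigenvalue_ordering_def bij_betw_def)
  obtain x where x: "x \<in> carrier_vec (d + 1)" "x \<noteq> 0\<^sub>v (d + 1)" "A *\<^sub>v x = \<theta>' j \<cdot>\<^sub>v x"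
    using img(2) A by (auto simp: eigenvalue_def eigenvector_def)
  have "\<theta>' j \<in> \<theta> ` {0..d}"
    using img(1) ij by simp
  then obtain k where k: "k \<le> d" "\<theta>' j = \<theta> k"
    by auto
  have "E' j *\<^sub>v x = x"
    using primitive_idempotent_eigenvector[OF A x(1) inj(2) ij(2) ij(2) x(3)] E by simp
  moreover have "E i *\<^sub>v x = (if k = i then 1 else 0) \<cdot>\<^sub>v x"
    using primitive_idempotent_eigenvector[OF A x(1) inj(1) ij(1) k(1)] x(3) k(2) E by simp
  moreover have "0 \<cdot>\<^sub>v x = 0\<^sub>v (d + 1)"
    using x(1) by (rule zero_smult)
  ultimately have "k = i"
    using x(2) ij(3) by (cases "k = i") simp_all
  then show ?thesis using k by simp
qed

section \<open>The two split decompositions\<close>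

text \<open>
  \<open>\<beta> v j\<close> is the coordinate of \<open>v\<close> along an eigenvector of \<open>A\<close> for \<open>\<theta> j\<close>.  With respect to the
  coordinates \<open>\<beta>\<close>, \<open>A\<close> is diagonal and \<open>D\<close> is tridiagonal; with respect to the standard
  coordinates, it is the other way round.
\<close>

locale leonard_coords = linear_coords d \<beta>
  for d :: nat and \<beta> :: "'a::field vec \<Rightarrow> nat \<Rightarrow> 'a" +
  fixes A D :: "'a mat" and \<theta> t :: "nat \<Rightarrow> 'a"
  assumes A_carrier: "A \<in> carrier_mat (d + 1) (d + 1)"
    and tridiag: "tridiagonal_mat A"
    and sub_nz: "i < d \<Longrightarrow> A $$ (Suc i, i) \<noteq> 0"
    and sup_nz: "i < d \<Longrightarrow> A $$ (i, Suc i) \<noteq> 0"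
    and D_eq: "D = mat (d + 1) (d + 1) (\<lambda>(r, c). if r = c then t r else 0)"
    and t_inj: "inj_on t {0..d}"
    and \<theta>_inj: "inj_on \<theta> {0..d}"
    and coord_A: "v \<in> carrier_vec (d + 1) \<Longrightarrow> j \<le> d \<Longrightarrow> \<beta> (A *\<^sub>v v) j = \<theta> j * \<beta> v j"
    and coord_D: "v \<in> carrier_vec (d + 1) \<Longrightarrow> i \<le> d \<Longrightarrow>
          (\<And>j. j \<le> d \<Longrightarrow> j \<le> i + 1 \<Longrightarrow> i \<le> j + 1 \<Longrightarrow> \<beta> v j = 0) \<Longrightarrow> \<beta> (D *\<^sub>v v) i = 0"
begin

lemma D_carrier: "D \<in> carrier_mat (d + 1) (d + 1)"
  by (simp add: D_eq)

lemma shifted_carrier [simp]: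
  "v \<in> carrier_vec (d + 1) \<Longrightarrow> shifted A s v \<in> carrier_vec (d + 1)"
  "v \<in> carrier_vec (d + 1) \<Longrightarrow> shifted D s v \<in> carrier_vec (d + 1)"
  using A_carrier D_carrier by (auto simp: shifted_def)

lemmas shifted_carrier_Suc [simp] = shifted_carrier[simplified]

lemma coord_shifted_A:
  assumes "v \<in> carrier_vec (d + 1)" "j \<le> d"
  shows "\<beta> (shifted A s v) j = (\<theta> j - s) * \<beta> v j"
  using assms A_carrier
  by (simp add: shifted_def coord_minus coord_A coord_smult algebra_simps)

lemma coord_shifted_D:
  assumes "v \<in> carrier_vec (d + 1)" "i \<le> d"
    and "\<And>j. j \<le> d \<Longrightarrow> j \<le> i + 1 \<Longrightarrow> i \<le> j + 1 \<Longrightarrow> \<beta> v j = 0"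
  shows "\<beta> (shifted D s v) i = 0"
  using assms D_carrier coord_D[OF assms]
  by (simp add: shifted_def coord_minus coord_smult)

lemma shifted_A_index:
  assumes v: "v \<in> carrier_vec (d + 1)" and i: "i \<le> d"
  shows "shifted A s v $ i =
    (if i = 0 then 0 else A $$ (i, i - 1) * v $ (i - 1)) + (A $$ (i, i) - s) * v $ i +
    (if i = d then 0 else A $$ (i, i + 1) * v $ (i + 1))"
proof -
  let ?f = "\<lambda>j. A $$ (i, j) * v $ j"
  let ?l = "if i = 0 then {} else {i - 1}" and ?r = "if i = d then {} else {i + 1}"
  have "(A *\<^sub>v v) $ i = (\<Sum>j\<in>{0..<d + 1}. ?f j)"
    using v i A_carrier by (auto simp: scalar_prod_def intro!: sum.cong)
  also have "\<dots> = (\<Sum>j\<in>?l \<union> {i} \<union> ?r. ?f j)"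
  proof (rule sum.mono_neutral_right)
    show "\<forall>j\<in>{0..<d + 1} - (?l \<union> {i} \<union> ?r). ?f j = 0"
    proof
      fix j assume j: "j \<in> {0..<d + 1} - (?l \<union> {i} \<union> ?r)"
      then have "\<bar>int i - int j\<bar> > 1"
        by (auto split: if_splits)
      then show "?f j = 0"
        using tridiag A_carrier i j by (auto simp: tridiagonal_mat_def)
    qed
  qed (use i in auto)
  also have "\<dots> = (if i = 0 then 0 else ?f (i - 1)) + ?f i + (if i = d then 0 else ?f (i + 1))"
    by (auto simp: algebra_simps)
  finally show ?thesis
    using v i A_carrier by (simp add: shifted_def algebra_simps)
qed

lemma shifted_D_index:
  assumes v: "v \<in> carrier_vec (d + 1)" and i: "i \<le> d"
  shows "shifted D s v $ i = (t i - s) * v $ i"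
proof -
  have "(D *\<^sub>v v) $ i = (\<Sum>j\<in>{0..<d + 1}. (if i = j then t i else 0) * v $ j)"
    using v i by (auto simp: D_eq scalar_prod_def intro!: sum.cong)
  also have "\<dots> = (\<Sum>j\<in>{0..<d + 1}. if i = j then t i * v $ j else 0)"
    by (rule sum.cong) auto
  also have "\<dots> = t i * v $ i"
    using i by simp
  finally show ?thesis
    using v i D_carrier by (simp add: shifted_def algebra_simps)
qed

text \<open>Downward induction on \<open>i\<close>: passing from \<open>v\<close> to
  \<open>(A - \<theta> i) v\<close> allows one more nonzero entry and kills coordinate
  \<open>i\<close> as well, and for \<open>i = d + 1\<close> all \<beta>-coordinates vanish.\<close>

lemma lower_coords_zero:
  assumes "v \<in> carrier_vec (d + 1)" "i \<le> d + 1"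
    and "\<And>j. i \<le> j \<Longrightarrow> j \<le> d \<Longrightarrow> v $ j = 0"
    and "\<And>j. j < i \<Longrightarrow> \<beta> v j = 0"
  shows "v = 0\<^sub>v (d + 1)"
  using assms(2,1,3,4)
proof (induction i arbitrary: v rule: inc_induct)
  case base
  then show ?case using coord_inj by auto
next
  case (step i)
  note v = step.prems(1)
  have i: "i \<le> d" using step.hyps by simp
  have s0: "shifted A (\<theta> i) v = 0\<^sub>v (d + 1)"
  proof (rule step.IH)
    fix j assume "Suc i \<le> j" "j \<le> d"
    then show "shifted A (\<theta> i) v $ j = 0"
      using step.prems(2) v by (simp add: shifted_A_index)
  next
    fix j assume "j < Suc i"
    then show "\<beta> (shifted A (\<theta> i) v) j = 0"
      using step.prems(3)[of j] v i by (cases "j = i") (auto simp: coord_shifted_A)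
  qed (use v in simp)
  \<comment> \<open>Now \<open>A v = \<theta> i v\<close>. Once the entries from
    \<open>Suc k\<close> on vanish, entry \<open>Suc k\<close> of this equation reduces to the
    nonzero subdiagonal entry times \<open>v $ k\<close>, so the zeros spread down from
    \<open>i\<close> to 0.\<close>
  have "\<forall>j\<ge>0. j \<le> d \<longrightarrow> v $ j = 0"
    using le0[of i]
  proof (induction rule: inc_induct)
    case base
    then show ?case using step.prems(2) by blast
  next
    case (step k)
    have "shifted A (\<theta> i) v $ Suc k = A $$ (Suc k, k) * v $ k"
      using step v i by (simp add: shifted_A_index)
    then have "v $ k = 0"
      using s0 step.hyps i sub_nz[of k] by simp
    show ?case
    proof (intro allI impI)
      fix j assume "k \<le> j" "j \<le> d"
      then show "v $ j = 0"
        using step.IH \<open>v $ k = 0\<close> by (cases "k = j") simp_all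
    qed
  qed
  then show ?case
    using v by (intro eq_vecI) auto
qed

text \<open>Mirror image of \<open>lower_coords_zero\<close>: leading zeros among the entries,
  trailing zeros among the \<beta>-coordinates. The shift by \<open>\<theta> m\<close> gives up one
  leading zero and kills coordinate \<open>m\<close>.\<close>

lemma upper_coords_zero:
  assumes "m \<le> d + 1" "v \<in> carrier_vec (d + 1)"
    and "\<And>j. j < m \<Longrightarrow> v $ j = 0"
    and "\<And>j. m \<le> j \<Longrightarrow> j \<le> d \<Longrightarrow> \<beta> v j = 0"
  shows "v = 0\<^sub>v (d + 1)"
  using assms
proof (induction m arbitrary: v)
  case 0
  then show ?case using coord_inj by auto
next
  case (Suc m)
  note v = Suc.prems(2)
  have m: "m \<le> d" using Suc.prems(1) by simp
  have s0: "shifted A (\<theta> m) v = 0\<^sub>v (d + 1)"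
  proof (rule Suc.IH)
    fix j assume "j < m"
    then show "shifted A (\<theta> m) v $ j = 0"
      using Suc.prems(3) v m by (simp add: shifted_A_index)
  next
    fix j assume "m \<le> j" "j \<le> d"
    then show "\<beta> (shifted A (\<theta> m) v) j = 0"
      using Suc.prems(4)[of j] v m by (cases "j = m") (auto simp: coord_shifted_A)
  qed (use v m in simp_all)
  \<comment> \<open>Here the superdiagonal entries carry the zeros upward: entry \<open>k\<close> of
    \<open>A v = \<theta> m v\<close> yields \<open>v $ Suc k = 0\<close>.\<close>
  have "\<forall>i\<le>k. v $ i = 0" if "m \<le> k" "k \<le> d" for k
    using that
  proof (induction rule: dec_induct)
    case base
    then show ?case using Suc.prems(3) by auto
  next
    case (step k)
    have "v $ k = 0" "v $ (k - 1) = 0"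
      using step by auto
    then have "shifted A (\<theta> m) v $ k = A $$ (k, Suc k) * v $ Suc k"
      using step.prems v by (simp add: shifted_A_index)
    then have "v $ Suc k = 0"
      using s0 step.prems sup_nz[of k] by simp
    then show ?case
      using step.IH step.prems by (simp add: le_Suc_eq)
  qed
  then have "\<forall>i\<le>d. v $ i = 0"
    using m by blast
  then show ?case
    using v by (intro eq_vecI) auto
qed

section \<open>Split spaces of the system and of its dual\<close>

definition U :: "nat \<Rightarrow> 'a vec set" where
  "U i = {v \<in> carrier_vec (d + 1). (\<forall>j\<le>d. i < j \<longrightarrow> v $ j = 0) \<and> (\<forall>j<i. \<beta> v j = 0)}"

text \<open>\<open>U\<close> with the two coordinate systems interchanged: the split spaces of the dual system.\<close>

definition W :: "nat \<Rightarrow> 'a vec set" where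
  "W i = {v \<in> carrier_vec (d + 1). (\<forall>j<i. v $ j = 0) \<and> (\<forall>j\<le>d. i < j \<longrightarrow> \<beta> v j = 0)}"

text \<open>\<open>U i\<close> is at most a line: the multiple of \<open>u\<close> is chosen to
  cancel entry \<open>i\<close>, and the difference then falls under
  \<open>lower_coords_zero\<close>.\<close>

lemma U_proportional:
  assumes i: "i \<le> d" and u: "u \<in> U i" "u $ i \<noteq> 0" and v: "v \<in> U i"
  shows "v = (v $ i / u $ i) \<cdot>\<^sub>v u"
proof -
  let ?w = "v - (v $ i / u $ i) \<cdot>\<^sub>v u"
  have uc: "u \<in> carrier_vec (d + 1)" and vc: "v \<in> carrier_vec (d + 1)"
    using u v by (auto simp: U_def)
  have "?w = 0\<^sub>v (d + 1)"
  proof (rule lower_coords_zero)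
    fix j assume "i \<le> j" "j \<le> d"
    then show "?w $ j = 0"
      using u v uc vc by (cases "i = j") (auto simp: U_def)
  next
    fix j assume "j < i"
    then show "\<beta> ?w j = 0"
      using u v i uc vc by (auto simp: U_def coord_minus coord_smult)
  qed (use uc vc i in auto)
  then show ?thesis
    using uc vc by (auto elim!: vec_eq_if_minus_zero[rotated 2])
qed

lemma W_proportional:
  assumes i: "i \<le> d" and u: "u \<in> W i" "u $ i \<noteq> 0" and v: "v \<in> W i"
  shows "v = (v $ i / u $ i) \<cdot>\<^sub>v u"
proof -
  let ?w = "v - (v $ i / u $ i) \<cdot>\<^sub>v u"
  have uc: "u \<in> carrier_vec (d + 1)" and vc: "v \<in> carrier_vec (d + 1)"
    using u v by (auto simp: W_def)
  have "?w = 0\<^sub>v (d + 1)"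
  \<comment> \<open>Cancelling entry \<open>i\<close> leaves zeros up to and including
    \<open>i\<close>, whence the threshold \<open>i + 1\<close>.\<close>
  proof (rule upper_coords_zero[of "i + 1"])
    fix j assume "j < i + 1"
    then show "?w $ j = 0"
      using u v uc vc i by (cases "i = j") (auto simp: W_def)
  next
    fix j assume "i + 1 \<le> j" "j \<le> d"
    then show "\<beta> ?w j = 0"
      using u v i uc vc by (auto simp: W_def coord_minus coord_smult)
  qed (use uc vc i in auto)
  then show ?thesis
    using uc vc by (auto elim!: vec_eq_if_minus_zero[rotated 2])
qed

lemma U_leading_nz:
  assumes "i \<le> d" "u \<in> U i" "u \<noteq> 0\<^sub>v (d + 1)"
  shows "u $ i \<noteq> 0"
proof
  assume u0: "u $ i = 0"
  have "u = 0\<^sub>v (d + 1)"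
  proof (rule lower_coords_zero[of u i])
    fix j assume "i \<le> j" "j \<le> d"
    then show "u $ j = 0"
      using u0 assms(2) by (cases "i = j") (auto simp: U_def)
  qed (use assms in \<open>auto simp: U_def\<close>)
  with assms(3) show False ..
qed

text \<open>Subtracting \<open>t i\<close> removes the last entry, while the tridiagonal shape of
  \<open>D\<close> in the \<beta>-coordinates costs one of the leading zeros there.\<close>

lemma shifted_D_U:
  assumes "0 < i" "i \<le> d" "u \<in> U i"
  shows "shifted D (t i) u \<in> U (i - 1)"
proof -
  have "shifted D (t i) u $ j = 0" if "j \<le> d" "i - 1 < j" for j
    using that assms by (cases "j = i") (auto simp: U_def shifted_D_index)
  moreover have "\<beta> (shifted D (t i) u) j = 0" if "j < i - 1" for j
    using that assms by (intro coord_shifted_D) (auto simp: U_def)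
  ultimately show ?thesis
    using assms by (auto simp: U_def)
qed

lemma shifted_A_U:
  assumes "i < d" "u \<in> U i"
  shows "shifted A (\<theta> i) u \<in> U (i + 1)"
proof -
  have "\<beta> (shifted A (\<theta> i) u) j = 0" if "j < i + 1" for j
    using that assms by (cases "j = i") (auto simp: U_def coord_shifted_A)
  then show ?thesis
    using assms by (auto simp: U_def shifted_A_index)
qed

lemma shifted_mult_shifted:
  assumes "v \<in> carrier_vec (d + 1)"
  shows "((A - r \<cdot>\<^sub>m 1\<^sub>m (d + 1)) * (D - s \<cdot>\<^sub>m 1\<^sub>m (d + 1))) *\<^sub>v v = shifted A r (shifted D s v)"
proof -
  have "((A - r \<cdot>\<^sub>m 1\<^sub>m (d + 1)) * (D - s \<cdot>\<^sub>m 1\<^sub>m (d + 1))) *\<^sub>v v =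
      (A - r \<cdot>\<^sub>m 1\<^sub>m (d + 1)) *\<^sub>v ((D - s \<cdot>\<^sub>m 1\<^sub>m (d + 1)) *\<^sub>v v)"
    using assms A_carrier D_carrier by (intro assoc_mult_mat_vec) auto
  then show ?thesis
    using assms A_carrier D_carrier by (simp add: minus_smult_one_mult_vec del: One_nat_def add_Suc_right)
qed

text \<open>Makes the \<open>THE\<close> in \<open>first_split_seq\<close> meaningful: all of
  \<open>U i\<close> consists of multiples of one vector, so a single eigenvector fixes the
  eigenvalue.\<close>

lemma split_eigenvalue_unique:
  assumes i: "i \<le> d" and u: "u \<in> U i" "u \<noteq> 0\<^sub>v (d + 1)"
    and eig: "shifted A r (shifted D s u) = c \<cdot>\<^sub>v u"
  shows "(THE c. \<exists>u\<in>U i. eigenvector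
    ((A - r \<cdot>\<^sub>m 1\<^sub>m (d + 1)) * (D - s \<cdot>\<^sub>m 1\<^sub>m (d + 1))) u c) = c"
proof -
  let ?M = "(A - r \<cdot>\<^sub>m 1\<^sub>m (d + 1)) * (D - s \<cdot>\<^sub>m 1\<^sub>m (d + 1))"
  have uc: "u \<in> carrier_vec (d + 1)" using u by (simp add: U_def)
  have M: "?M \<in> carrier_mat (d + 1) (d + 1)" using A_carrier D_carrier by auto
  then have row: "dim_row ?M = d + 1" by blast
  have e: "?M *\<^sub>v u = c \<cdot>\<^sub>v u"
    using eig shifted_mult_shifted[OF uc] by simp
  have uniq: "c' = c" if v: "v \<in> U i" and ev: "eigenvector ?M v c'" for v c'
  proof -
    define b where "b = v $ i / u $ i"
    have vb: "v = b \<cdot>\<^sub>v u"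
      unfolding b_def using U_proportional[OF i u(1) U_leading_nz[OF i u] v] .
    have vn: "v \<noteq> 0\<^sub>v (d + 1)" "?M *\<^sub>v v = c' \<cdot>\<^sub>v v"
      using ev row by (auto simp: eigenvector_def)
    have "?M *\<^sub>v v = b \<cdot>\<^sub>v (?M *\<^sub>v u)"
      unfolding vb using M uc by (rule mult_mat_vec)
    then have "c' \<cdot>\<^sub>v v = c \<cdot>\<^sub>v v"
      using vn(2) e vb by (simp add: smult_smult_assoc mult.commute)
    then have "(c' \<cdot>\<^sub>v v) $ i = (c \<cdot>\<^sub>v v) $ i"
      by simp
    moreover have "v \<in> carrier_vec (d + 1)" using v by (simp add: U_def)
    ultimately show ?thesis
      using i U_leading_nz[OF i v vn(1)] by simp
  qed
  show ?thesis
  proof (rule the_equality)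
    show "\<exists>u\<in>U i. eigenvector ?M u c"
      using u uc e row by (auto simp: eigenvector_def)
  qed (use uniq in blast)
qed

text \<open>\<open>first_split_seq\<close> with \<open>U i\<close> in place of
  \<open>split_space\<close>; the two are identified in
  \<open>leonard_coords_exists\<close>.\<close>

definition split_val :: "nat \<Rightarrow> 'a" where
  "split_val i = (THE c. \<exists>u\<in>U i. eigenvector
    ((A - \<theta> (i - 1) \<cdot>\<^sub>m 1\<^sub>m (d + 1)) * (D - t i \<cdot>\<^sub>m 1\<^sub>m (d + 1))) u c)"

lemma split_val_eqI:
  assumes "0 < i" "i \<le> d" "u \<in> U i" "u \<noteq> 0\<^sub>v (d + 1)"
    and "shifted A (\<theta> (i - 1)) (shifted D (t i) u) = c \<cdot>\<^sub>v u"
  shows "split_val i = c"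
  unfolding split_val_def using assms by (intro split_eigenvalue_unique) auto

lemma shifted_smult:
  assumes "M \<in> carrier_mat (d + 1) (d + 1)" "v \<in> carrier_vec (d + 1)"
  shows "shifted M c (s \<cdot>\<^sub>v v) = s \<cdot>\<^sub>v shifted M c v"
  using assms mult_mat_vec[OF assms, of s] unfolding shifted_def
  by (intro eq_vecI) (auto simp: algebra_simps)

lemma t_diff_nz:
  assumes "i \<le> d" "j \<le> d" "i \<noteq> j"
  shows "t i - t j \<noteq> 0"
  using t_inj assms by (auto dest: inj_onD)

section \<open>The split basis generated from the first unit vector, and the diagonal
  entries\<close>

primrec u_vec :: "nat \<Rightarrow> 'a vec" where
  "u_vec 0 = unit_vec (d + 1) 0"
| "u_vec (Suc i) = shifted A (\<theta> i) (u_vec i)"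

lemma u_vec_in_U: "i \<le> d \<Longrightarrow> u_vec i \<in> U i"
proof (induction i)
  case 0
  then show ?case by (auto simp: U_def)
next
  case (Suc i)
  then show ?case using shifted_A_U[of i "u_vec i"] by simp
qed

lemma u_vec_leading:
  assumes "i < d"
  shows "u_vec (Suc i) $ Suc i = A $$ (Suc i, i) * u_vec i $ i"
  using u_vec_in_U[of i] assms by (auto simp: U_def shifted_A_index)

lemma u_vec_leading_nz: "i \<le> d \<Longrightarrow> u_vec i $ i \<noteq> 0"
proof (induction i)
  case (Suc i)
  then show ?case using u_vec_leading[of i] sub_nz[of i] by (simp del: u_vec.simps)
qed simp

lemma u_vec_carrier: "i \<le> d \<Longrightarrow> u_vec i \<in> carrier_vec (d + 1)"
  using u_vec_in_U by (simp add: U_def)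

text \<open>The left side lies in \<open>U i\<close>, hence is \<open>c\<close> times
  \<open>u_vec i\<close>; applying \<open>A - \<theta> i\<close> turns it into \<open>c\<close>
  times \<open>u_vec (Suc i)\<close>, so \<open>c\<close> is the eigenvalue that defines
  \<open>split_val\<close>.\<close>

lemma shifted_D_u_vec:
  assumes i: "i < d"
  shows "shifted D (t (Suc i)) (u_vec (Suc i)) = split_val (Suc i) \<cdot>\<^sub>v u_vec i"
proof -
  let ?v = "shifted D (t (Suc i)) (u_vec (Suc i))"
  define c where "c = ?v $ i / u_vec i $ i"
  have "?v \<in> U i"
    using shifted_D_U[of "Suc i" "u_vec (Suc i)"] u_vec_in_U[of "Suc i"] i by simp
  then have v: "?v = c \<cdot>\<^sub>v u_vec i"
    unfolding c_def using i by (intro U_proportional u_vec_in_U u_vec_leading_nz) auto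
  have "split_val (Suc i) = c"
  proof (rule split_val_eqI)
    show "u_vec (Suc i) \<noteq> 0\<^sub>v (d + 1)"
      using u_vec_leading_nz[of "Suc i"] i by (auto simp del: u_vec.simps)
    show "shifted A (\<theta> (Suc i - 1)) ?v = c \<cdot>\<^sub>v u_vec (Suc i)"
      unfolding v using i by (simp add: shifted_smult[OF A_carrier u_vec_carrier])
  qed (use i u_vec_in_U[of "Suc i"] in simp_all)
  then show ?thesis using v by simp
qed

lemma u_vec_subleading:
  assumes i: "i < d"
  shows "u_vec (Suc i) $ i = split_val (Suc i) * u_vec i $ i / (t i - t (Suc i))"
proof -
  have "(t i - t (Suc i)) * u_vec (Suc i) $ i = split_val (Suc i) * u_vec i $ i"
    using arg_cong[OF shifted_D_u_vec[OF i], of "\<lambda>v. v $ i"] i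
      u_vec_carrier[of i] u_vec_carrier[of "Suc i"]
    by (simp add: shifted_D_index del: u_vec.simps)
  then show ?thesis
    using t_diff_nz[of i "Suc i"] i by (simp add: field_simps)
qed

text \<open>Read entry \<open>i\<close> of \<open>(A - \<theta> i) u_i = u_(i+1)\<close> and express
  the entries next to the leading ones through \<open>u_vec_subleading\<close>.\<close>

lemma diag_entry_split_val:
  assumes i: "i < d"
  shows "A $$ (i, i) = \<theta> i + (if i = 0 then 0 else split_val i / (t i - t (i - 1))) +
    split_val (Suc i) / (t i - t (Suc i))"
proof -
  have "u_vec i $ Suc i = 0"
    using u_vec_in_U[of i] i by (auto simp: U_def)
  then have eq: "u_vec (Suc i) $ i =
      (if i = 0 then 0 else A $$ (i, i - 1) * u_vec i $ (i - 1)) + (A $$ (i, i) - \<theta> i) * u_vec i $ i"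
    using i u_vec_carrier[of i] by (simp add: shifted_A_index)
  \<comment> \<open>The unknown subdiagonal entry drops out, because \<open>u_vec_leading\<close>
    absorbs it into \<open>u_vec i $ i\<close>.\<close>
  have sub: "(if i = 0 then 0 else A $$ (i, i - 1) * u_vec i $ (i - 1)) =
      (if i = 0 then 0 else split_val i / (t (i - 1) - t i)) * u_vec i $ i"
  proof (cases i)
    case (Suc k)
    then show ?thesis
      using i u_vec_leading[of k] u_vec_subleading[of k] by (simp del: u_vec.simps)
  qed simp
  have nz: "u_vec i $ i \<noteq> 0"
    using u_vec_leading_nz[of i] i by simp
  have "split_val (Suc i) / (t i - t (Suc i)) * u_vec i $ i =
      ((if i = 0 then 0 else split_val i / (t (i - 1) - t i)) + (A $$ (i, i) - \<theta> i)) * u_vec i $ i"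
    using eq unfolding sub u_vec_subleading[OF i] by (simp add: algebra_simps)
  then have "split_val (Suc i) / (t i - t (Suc i)) =
      (if i = 0 then 0 else split_val i / (t (i - 1) - t i)) + (A $$ (i, i) - \<theta> i)"
    by (rule iffD1[OF mult_right_cancel[OF nz]])
  moreover have "split_val i / (t (i - 1) - t i) = - (split_val i / (t i - t (i - 1)))"
    by (metis minus_diff_eq minus_divide_right)
  ultimately show ?thesis
    by (auto simp: algebra_simps split: if_splits)
qed

section \<open>The all-ones vector and the subdiagonal entries\<close>

definition ones :: "'a vec" where
  "ones = vec (d + 1) (\<lambda>_. 1)"

text \<open>The index \<open>k\<close> is left free because the eigenvalue of the all-ones vector
  has index 0 in the given eigenvalue sequence and index \<open>d\<close> in the reversed
  one.\<close>

lemma coord_ones: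
  assumes eig: "A *\<^sub>v ones = \<theta> k \<cdot>\<^sub>v ones" and k: "k \<le> d" and j: "j \<le> d" "j \<noteq> k"
  shows "\<beta> ones j = 0"
proof -
  have c: "ones \<in> carrier_vec (d + 1)" by (simp add: ones_def)
  have "\<theta> j * \<beta> ones j = \<theta> k * \<beta> ones j"
    using coord_A[OF c j(1)] coord_smult[OF c j(1), of "\<theta> k"] unfolding eig by metis
  moreover have "\<theta> j \<noteq> \<theta> k"
    using \<theta>_inj j k by (auto dest: inj_onD)
  ultimately show ?thesis by auto
qed

text \<open>The product of \<open>D - t h\<close> over \<open>h > k\<close>, applied to the all-ones
  vector.\<close>

definition suffix_vec :: "nat \<Rightarrow> 'a vec" where
  "suffix_vec k = vec (d + 1) (\<lambda>j. \<Prod>h\<in>{k + 1..d}. t j - t h)"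

lemma shifted_D_suffix_vec:
  assumes "0 < k" "k \<le> d"
  shows "shifted D (t k) (suffix_vec k) = suffix_vec (k - 1)"
proof (rule eq_vecI)
  fix j assume "j < dim_vec (suffix_vec (k - 1))"
  then have j: "j \<le> d" by (simp add: suffix_vec_def)
  have "{k - 1 + 1..d} = insert k {k + 1..d}"
    using assms by auto
  then show "shifted D (t k) (suffix_vec k) $ j = suffix_vec (k - 1) $ j"
    using j by (simp add: shifted_D_index suffix_vec_def)
qed (simp add: shifted_def D_eq suffix_vec_def)

lemma suffix_vec_diag_nz: "k \<le> d \<Longrightarrow> suffix_vec k $ k \<noteq> 0"
  using t_diff_nz by (auto simp: suffix_vec_def)

text \<open>The hypothesis with \<open>\<theta> d\<close> fits the reversed system. It puts the
  all-ones vector into \<open>U d\<close>, and each factor of \<open>suffix_vec\<close> then steps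
  down one split space.\<close>

lemma suffix_vec_in_U:
  assumes eig: "A *\<^sub>v ones = \<theta> d \<cdot>\<^sub>v ones" and "k \<le> d"
  shows "suffix_vec k \<in> U k"
  using assms(2)
proof (induction k rule: inc_induct)
  case base
  have "suffix_vec d = ones"
    by (auto simp: suffix_vec_def ones_def)
  then show ?case
    using coord_ones[OF eig] by (auto simp: U_def ones_def)
next
  case (step k)
  then show ?case
    using shifted_D_U[of "Suc k" "suffix_vec (Suc k)"] shifted_D_suffix_vec[of "Suc k"] by simp
qed

text \<open>The roles are exchanged relative to \<open>u_vec\<close>: for the suffix vectors the
  step by \<open>D\<close> is exact and the step by \<open>A\<close> carries the split value. Entry
  \<open>k\<close> of the latter isolates the subdiagonal entry.\<close>

lemma sub_entry_split_val:
  assumes eig: "A *\<^sub>v ones = \<theta> d \<cdot>\<^sub>v ones" and k: "0 < k" "k \<le> d"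
  shows "A $$ (k, k - 1) =
    split_val k * (\<Prod>h\<in>{k + 1..d}. t k - t h) / (\<Prod>h\<in>{k..d}. t (k - 1) - t h)"
proof -
  have c: "suffix_vec j \<in> carrier_vec (d + 1)" for j
    by (simp add: suffix_vec_def)
  let ?v = "shifted A (\<theta> (k - 1)) (suffix_vec (k - 1))"
  define r where "r = ?v $ k / suffix_vec k $ k"
  have prev: "suffix_vec (k - 1) \<in> U (k - 1)"
    using suffix_vec_in_U[OF eig] k by simp
  have "?v \<in> U k"
    using shifted_A_U[OF _ prev] k by simp
  then have v: "?v = r \<cdot>\<^sub>v suffix_vec k"
    unfolding r_def using k
    by (intro U_proportional suffix_vec_in_U[OF eig] suffix_vec_diag_nz)
  have "split_val k = r"
  proof (rule split_val_eqI)
    show "suffix_vec k \<noteq> 0\<^sub>v (d + 1)"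
      using suffix_vec_diag_nz[OF k(2)] k by auto
    show "shifted A (\<theta> (k - 1)) (shifted D (t k) (suffix_vec k)) = r \<cdot>\<^sub>v suffix_vec k"
      using v k by (simp add: shifted_D_suffix_vec)
  qed (use k suffix_vec_in_U[OF eig] in auto)
  \<comment> \<open>\<open>suffix_vec (k - 1)\<close> has no entries beyond \<open>k - 1\<close>, so
    row \<open>k\<close> of \<open>A\<close> meets it only in the subdiagonal.\<close>
  moreover have "?v $ k = A $$ (k, k - 1) * suffix_vec (k - 1) $ (k - 1)"
    using prev k c by (auto simp: shifted_A_index U_def)
  moreover have "?v $ k = r * suffix_vec k $ k"
    using v k c[of k] by simp
  ultimately have "A $$ (k, k - 1) * suffix_vec (k - 1) $ (k - 1) = split_val k * suffix_vec k $ k"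
    by simp
  then have "A $$ (k, k - 1) = split_val k * suffix_vec k $ k / suffix_vec (k - 1) $ (k - 1)"
    using suffix_vec_diag_nz[of "k - 1"] k by (simp add: field_simps)
  then show ?thesis
    using k by (simp add: suffix_vec_def)
qed

section \<open>The dual split decomposition and the superdiagonal entries\<close>

lemma shifted_D_W:
  assumes "i < d" "w \<in> W i"
  shows "shifted D (t i) w \<in> W (Suc i)"
proof -
  have "shifted D (t i) w $ j = 0" if "j < Suc i" for j
    using that assms by (cases "j = i") (auto simp: W_def shifted_D_index)
  moreover have "\<beta> (shifted D (t i) w) j = 0" if "j \<le> d" "Suc i < j" for j
    using that assms by (intro coord_shifted_D) (auto simp: W_def)
  ultimately show ?thesis
    using assms by (auto simp: W_def)
qed

lemma shifted_A_W:
  assumes "Suc i \<le> d" "w \<in> W (Suc i)"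
  shows "shifted A (\<theta> (Suc i)) w \<in> W i"
proof -
  have "\<beta> (shifted A (\<theta> (Suc i)) w) j = 0" if "j \<le> d" "i < j" for j
    using that assms by (cases "j = Suc i") (auto simp: W_def coord_shifted_A)
  then show ?thesis
    using assms by (auto simp: W_def shifted_A_index)
qed

definition prefix_vec :: "nat \<Rightarrow> 'a vec" where
  "prefix_vec k = vec (d + 1) (\<lambda>j. \<Prod>h\<in>{0..<k}. t j - t h)"

lemma prefix_vec_carrier: "prefix_vec k \<in> carrier_vec (d + 1)"
  by (simp add: prefix_vec_def)

lemma prefix_vec_Suc_index: "j \<le> d \<Longrightarrow> prefix_vec (Suc k) $ j = (t j - t k) * prefix_vec k $ j"
  by (simp add: prefix_vec_def)

lemma shifted_D_prefix_vec: "shifted D (t k) (prefix_vec k) = prefix_vec (Suc k)"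
proof (rule eq_vecI)
  fix j assume "j < dim_vec (prefix_vec (Suc k))"
  then have "j \<le> d" by (simp add: prefix_vec_def)
  then show "shifted D (t k) (prefix_vec k) $ j = prefix_vec (Suc k) $ j"
    by (simp add: shifted_D_index[OF prefix_vec_carrier] prefix_vec_Suc_index)
qed (simp add: shifted_def D_eq prefix_vec_def)

lemma prefix_vec_nz: "k \<le> j \<Longrightarrow> j \<le> d \<Longrightarrow> prefix_vec k $ j \<noteq> 0"
  using t_diff_nz by (auto simp: prefix_vec_def)

lemma prefix_vec_in_W:
  assumes eig: "A *\<^sub>v ones = \<theta> 0 \<cdot>\<^sub>v ones"
  shows "k \<le> d \<Longrightarrow> prefix_vec k \<in> W k"
proof (induction k)
  case 0
  have "prefix_vec 0 = ones"
    by (auto simp: prefix_vec_def ones_def)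
  then show ?case
    using coord_ones[OF eig] by (auto simp: W_def ones_def)
next
  case (Suc k)
  then show ?case
    using shifted_D_W[of k "prefix_vec k"] by (simp add: shifted_D_prefix_vec)
qed

text \<open>The multiplier \<open>s\<^sub>k\<close>, read off from the entry with index \<open>k - 1\<close>.\<close>

definition dual_split :: "nat \<Rightarrow> 'a" where
  "dual_split k = A $$ (k - 1, k) * prefix_vec k $ k / prefix_vec (k - 1) $ (k - 1)"

text \<open>The left side lies in \<open>W k\<close>, all of whose vectors are multiples of
  \<open>prefix_vec k\<close>. Since \<open>prefix_vec (Suc k)\<close> has no entries before
  \<open>Suc k\<close>, row \<open>k\<close> of \<open>A\<close> meets it only in the superdiagonal,
  and this gives the factor.\<close>

lemma shifted_A_prefix_vec:
  assumes eig: "A *\<^sub>v ones = \<theta> 0 \<cdot>\<^sub>v ones" and k: "Suc k \<le> d"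
  shows "shifted A (\<theta> (Suc k)) (prefix_vec (Suc k)) = dual_split (Suc k) \<cdot>\<^sub>v prefix_vec k"
proof -
  let ?v = "shifted A (\<theta> (Suc k)) (prefix_vec (Suc k))"
  have "?v = (?v $ k / prefix_vec k $ k) \<cdot>\<^sub>v prefix_vec k"
    using k by (intro W_proportional shifted_A_W prefix_vec_in_W[OF eig] prefix_vec_nz) auto
  moreover have "?v $ k = A $$ (k, Suc k) * prefix_vec (Suc k) $ Suc k"
    using prefix_vec_in_W[OF eig k] k by (auto simp: W_def shifted_A_index)
  ultimately show ?thesis
    by (simp add: dual_split_def)
qed

text \<open>Read entry \<open>i\<close> of \<open>(A - \<theta> i) w_i = s_i w_(i-1)\<close>, where
  \<open>w\<close> is \<open>prefix_vec\<close> and \<open>s\<close> is \<open>dual_split\<close>.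
  The subdiagonal does not contribute since \<open>w_i\<close> starts at entry
  \<open>i\<close>.\<close>

lemma diag_entry_dual_split:
  assumes eig: "A *\<^sub>v ones = \<theta> 0 \<cdot>\<^sub>v ones" and i: "i \<le> d"
  shows "A $$ (i, i) = \<theta> i + (if i = 0 then 0 else dual_split i / (t i - t (i - 1))) +
    (if i = d then 0 else dual_split (i + 1) / (t i - t (i + 1)))"
proof -
  let ?p = "prefix_vec i $ i"
  have pc: "prefix_vec i \<in> W i"
    by (rule prefix_vec_in_W[OF eig i])
  have nz: "?p \<noteq> 0"
    using prefix_vec_nz i by simp
  have "shifted A (\<theta> i) (prefix_vec i) $ i =
      (A $$ (i, i) - \<theta> i) * ?p + (if i = d then 0 else A $$ (i, i + 1) * prefix_vec i $ (i + 1))"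
    using pc i by (auto simp: shifted_A_index W_def)
  moreover have "shifted A (\<theta> i) (prefix_vec i) $ i =
      (if i = 0 then 0 else dual_split i / (t i - t (i - 1))) * ?p"
  proof (cases i)
    case 0
    \<comment> \<open>Here the right side is zero, because the all-ones vector is an eigenvector for
      \<open>\<theta> 0\<close>.\<close>
    have "prefix_vec 0 = ones"
      by (auto simp: prefix_vec_def ones_def)
    moreover have "shifted A (\<theta> 0) ones = 0\<^sub>v (d + 1)"
      using eig by (auto simp: shifted_def ones_def)
    ultimately show ?thesis
      using 0 by simp
  next
    case (Suc k)
    then have "?p = (t i - t k) * prefix_vec k $ i" "t i - t k \<noteq> 0"
      using i t_diff_nz[of i k] by (simp_all add: prefix_vec_Suc_index)
    then show ?thesis
      using Suc i shifted_A_prefix_vec[OF eig, of k] prefix_vec_carrier[of k] by simp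
  qed
  \<comment> \<open>At entry \<open>Suc i\<close>, \<open>prefix_vec (Suc i)\<close> has the extra
    factor \<open>t (Suc i) - t i\<close> over \<open>prefix_vec i\<close>. This turns the
    superdiagonal term into \<open>dual_split\<close>, and the orientation of the difference gives
    the sign.\<close>
  moreover have "(if i = d then 0 else A $$ (i, i + 1) * prefix_vec i $ (i + 1)) =
      - (if i = d then 0 else dual_split (i + 1) / (t i - t (i + 1))) * ?p"
  proof (cases "i = d")
    case False
    then have p: "prefix_vec (Suc i) $ Suc i = (t (Suc i) - t i) * prefix_vec i $ Suc i"
      and "t (Suc i) - t i \<noteq> 0"
      using i t_diff_nz[of "Suc i" i] by (simp_all add: prefix_vec_Suc_index)
    moreover have "dual_split (Suc i) / (t i - t (Suc i)) = - (dual_split (Suc i) / (t (Suc i) - t i))"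
      by (metis minus_diff_eq minus_divide_right)
    ultimately show ?thesis
      using nz False by (simp add: dual_split_def p del: right_minus_eq)
  qed simp
  ultimately have "(A $$ (i, i) - \<theta> i) * ?p =
      ((if i = 0 then 0 else dual_split i / (t i - t (i - 1))) +
       (if i = d then 0 else dual_split (i + 1) / (t i - t (i + 1)))) * ?p"
    by (simp add: algebra_simps)
  then have "A $$ (i, i) - \<theta> i =
      (if i = 0 then 0 else dual_split i / (t i - t (i - 1))) +
      (if i = d then 0 else dual_split (i + 1) / (t i - t (i + 1)))"
    by (rule iffD1[OF mult_right_cancel[OF nz]])
  then show ?thesis
    by (simp add: algebra_simps)
qed

text \<open>The same diagonal entry has two formulas of the same shape. By induction their terms
  with the earlier index agree and cancel, and the nonzero denominator then identifies the next
  pair; the first row has no earlier term.\<close>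

lemma split_val_eq_dual_split:
  assumes eig: "A *\<^sub>v ones = \<theta> 0 \<cdot>\<^sub>v ones"
  shows "i < d \<Longrightarrow> split_val (Suc i) = dual_split (Suc i)"
proof (induction i)
  case 0
  then show ?case
    using diag_entry_split_val[of 0] diag_entry_dual_split[OF eig, of 0] t_diff_nz[of 0 1]
    by simp
next
  case (Suc i)
  then show ?case
    using diag_entry_split_val[of "Suc i"] diag_entry_dual_split[OF eig, of "Suc i"]
      t_diff_nz[of "Suc i" "Suc (Suc i)"]
    by simp
qed

text \<open>The formula is taken from \<open>diag_entry_dual_split\<close>, which unlike
  \<open>diag_entry_split_val\<close> also reaches the row \<open>i = d\<close>.\<close>

lemma diag_entry:
  assumes eig: "A *\<^sub>v ones = \<theta> 0 \<cdot>\<^sub>v ones" and i: "i \<le> d"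
  shows "A $$ (i, i) = \<theta> i + (if i = 0 then 0 else split_val i / (t i - t (i - 1))) +
    (if i = d then 0 else split_val (i + 1) / (t i - t (i + 1)))"
  using diag_entry_dual_split[OF eig i] split_val_eq_dual_split[OF eig, of i]
    split_val_eq_dual_split[OF eig, of "i - 1"] i
  by (auto simp: gr0_conv_Suc)

lemma sup_entry:
  assumes eig: "A *\<^sub>v ones = \<theta> 0 \<cdot>\<^sub>v ones" and k: "0 < k" "k \<le> d"
  shows "A $$ (k - 1, k) =
    split_val k * (\<Prod>h\<in>{0..<k - 1}. t (k - 1) - t h) / (\<Prod>h\<in>{0..<k}. t k - t h)"
proof -
  have "split_val k = A $$ (k - 1, k) * prefix_vec k $ k / prefix_vec (k - 1) $ (k - 1)"
    using split_val_eq_dual_split[OF eig, of "k - 1"] k by (simp add: dual_split_def)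
  then have "A $$ (k - 1, k) = split_val k * prefix_vec (k - 1) $ (k - 1) / prefix_vec k $ k"
    using prefix_vec_nz[of k k] prefix_vec_nz[of "k - 1" "k - 1"] k by (simp add: field_simps)
  then show ?thesis
    using k by (simp add: prefix_vec_def)
qed

end

section \<open>Canonical form\<close>

lemma diagonal_mat_mult_vec_index:
  fixes D :: "'a::field mat"
  assumes D: "D \<in> carrier_mat n n" "diagonal_mat D" and x: "x \<in> carrier_vec n" and k: "k < n"
  shows "(D *\<^sub>v x) $ k = D $$ (k, k) * x $ k"
proof -
  have "(D *\<^sub>v x) $ k = (\<Sum>j\<in>{0..<n}. D $$ (k, j) * x $ j)"
    using D x k by (simp add: scalar_prod_def)
  also have "\<dots> = (\<Sum>j\<in>{0..<n}. if j = k then D $$ (k, k) * x $ k else 0)"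
    using D k by (intro sum.cong) (auto simp: diagonal_mat_def)
  finally show ?thesis using k by simp
qed

text \<open>The diagonal of \<open>D\<close> is a rearrangement of \<open>t\<close> by a permutation
  \<tau>. The entries of \<open>A\<close> between the positions \<tau> assigns to neighbouring
  indices are nonzero, so by tridiagonality \<tau> moves in single steps; being injective and fixing
  0, it is the identity.\<close>

lemma diagonal_mat_eigenvalue_order:
  fixes A D :: "'a::field mat"
  assumes A: "A \<in> carrier_mat (d + 1) (d + 1)" "tridiagonal_mat A"
    and D: "D \<in> carrier_mat (d + 1) (d + 1)" "diagonal_mat D" "D $$ (0, 0) = t 0"
    and assoc: "associated_eigenvalues d D E t"
    and nz: "\<forall>i\<le>d. \<forall>j\<le>d. \<bar>int i - int j\<bar> = 1 \<longrightarrow>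
      E i * A * E j \<noteq> 0\<^sub>m (d + 1) (d + 1)"
  shows "D = mat (d + 1) (d + 1) (\<lambda>(r, c). if r = c then t r else 0)"
    and "\<forall>i\<le>d. \<forall>j\<le>d. \<bar>int i - int j\<bar> = 1 \<longrightarrow> A $$ (i, j) \<noteq> 0"
    and "idempotent_coords d (\<lambda>v k. v $ k) E"
proof -
  define n where "n = d + 1"
  note A = A[folded n_def] and D = D[folded n_def]
  have img: "t ` {0..d} = {s. eigenvalue D s}" and inj: "inj_on t {0..d}"
    and E: "\<And>i. i \<le> d \<Longrightarrow> E i = primitive_idempotent d D t i"
    using assoc by (auto simp: associated_eigenvalues_def eigenvalue_ordering_def bij_betw_def)
  have Ec: "E i \<in> carrier_mat n n" if "i \<le> d" for i
    using E[OF that] primitive_idempotent_carrier[of D d] D(1) by (simp add: n_def)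
  have "\<exists>k\<le>d. D $$ (k, k) = t i" if i: "i \<le> d" for i
  proof -
    have "t i \<in> t ` {0..d}" using i by simp
    then have "eigenvalue D (t i)" unfolding img by simp
    then obtain x where x: "x \<in> carrier_vec n" "x \<noteq> 0\<^sub>v n" "D *\<^sub>v x = t i \<cdot>\<^sub>v x"
      using D(1) by (auto simp: eigenvalue_def eigenvector_def)
    obtain k where k: "k < n" "x $ k \<noteq> 0"
      using x(1,2) by (metis carrier_vecD eq_vecI index_zero_vec)
    have "D $$ (k, k) * x $ k = t i * x $ k"
      using diagonal_mat_mult_vec_index[OF D(1,2) x(1) k(1)] x k by simp
    then have "D $$ (k, k) = t i" using k(2) by simp
    then show ?thesis using k(1) by (intro exI[of _ k]) (simp add: n_def)
  qed
  \<comment> \<open>\<open>\<tau> i\<close> is to be the position of \<open>t i\<close> on the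
    diagonal.\<close>
  then have "\<forall>i. \<exists>k. i \<le> d \<longrightarrow> k \<le> d \<and> D $$ (k, k) = t i"
    by blast
  from choice[OF this] obtain \<tau> where \<tau>: "\<And>i. i \<le> d \<Longrightarrow> \<tau> i \<le> d \<and> D $$ (\<tau> i, \<tau> i) = t i"
    by blast
  have \<tau>_inj: "inj_on \<tau> {0..d}"
  proof (rule inj_onI)
    fix i j assume ij: "i \<in> {0..d}" "j \<in> {0..d}" "\<tau> i = \<tau> j"
    then have "t i = t j"
      using \<tau>[of i] \<tau>[of j] by simp
    then show "i = j"
      by (rule inj_onD[OF inj _ ij(1,2)])
  qed
  have \<tau>_surj: "\<tau> ` {0..d} = {0..d}"
  proof (rule endo_inj_surj[OF _ _ \<tau>_inj])
    show "\<tau> ` {0..d} \<subseteq> {0..d}"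
      using \<tau> by fastforce
  qed simp
  \<comment> \<open>Unit vectors are eigenvectors of \<open>D\<close>; they are written as columns
    of the identity matrix to fit \<open>mult_eigenbasis\<close>.\<close>
  have Ee: "E j *\<^sub>v col (1\<^sub>m n) k = (if k = \<tau> j then 1 else 0) \<cdot>\<^sub>v col (1\<^sub>m n) k"
    if j: "j \<le> d" and k: "k < n" for j k
  proof -
    have "k \<in> \<tau> ` {0..d}"
      using k \<tau>_surj by (simp add: n_def)
    then obtain i where i: "i \<le> d" "k = \<tau> i" by auto
    have "D *\<^sub>v unit_vec n k = t i \<cdot>\<^sub>v unit_vec n k"
    proof (rule eq_vecI)
      fix r assume "r < dim_vec (t i \<cdot>\<^sub>v unit_vec n k :: 'a vec)"
      then show "(D *\<^sub>v unit_vec n k) $ r = (t i \<cdot>\<^sub>v unit_vec n k) $ r"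
        using diagonal_mat_mult_vec_index[OF D(1,2) unit_vec_carrier, of r k] k i \<tau>[OF i(1)] by simp
    qed (use D(1) in simp)
    then have "E j *\<^sub>v unit_vec n k = (if i = j then 1 else 0) \<cdot>\<^sub>v unit_vec n k"
      using primitive_idempotent_eigenvector[of D d "unit_vec n k" t j i] D(1) inj i j E[OF j]
      by (simp add: n_def)
    moreover have "(i = j) = (k = \<tau> j)"
      using \<tau>_inj i j by (auto dest: inj_onD)
    ultimately show ?thesis
      using k by simp
  qed
  have Ev: "(E j *\<^sub>v v) $ r = (if r = \<tau> j then v $ r else 0)"
    if j: "j \<le> d" and v: "v \<in> carrier_vec n" and r: "r < n" for j v r
  proof -
    have "E j *\<^sub>v (1\<^sub>m n *\<^sub>v v) = 1\<^sub>m n *\<^sub>v vec n (\<lambda>k. (if k = \<tau> j then 1 else 0) * v $ k)"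
      by (rule mult_eigenbasis[OF Ec[OF j] one_carrier_mat Ee[OF j] v])
    then have "E j *\<^sub>v v = vec n (\<lambda>k. (if k = \<tau> j then 1 else 0) * v $ k)"
      using one_mult_mat_vec[OF v] one_mult_mat_vec[OF vec_carrier] by metis
    then show ?thesis using r by simp
  qed
  have A_index: "(A *\<^sub>v w) $ k = (\<Sum>c\<in>{0..<n}. A $$ (k, c) * w $ c)"
    if "w \<in> carrier_vec n" "k < n" for w k
    using A(1) that by (simp add: scalar_prod_def)
  have A_zero: "A $$ (i, j) = 0" if "i < n" "j < n" "\<bar>int i - int j\<bar> > 1" for i j
    using A that by (simp add: tridiagonal_mat_def)
  \<comment> \<open>\<open>E i * A * E j\<close> can only be nonzero in its entry at
    \<open>(\<tau> i, \<tau> j)\<close>, which is the entry of \<open>A\<close> there; were it zero,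
    the whole product would vanish.\<close>
  have A_nz: "A $$ (\<tau> i, \<tau> j) \<noteq> 0"
    if ij: "i \<le> d" "j \<le> d" "\<bar>int i - int j\<bar> = 1" for i j
  proof
    assume zero: "A $$ (\<tau> i, \<tau> j) = 0"
    have "E i * A * E j = 0\<^sub>m n n"
    proof (rule mat_eqI_mult_vec)
      show "E i * A * E j \<in> carrier_mat n n"
        by (rule mult_carrier_mat[OF mult_carrier_mat[OF Ec[OF ij(1)] A(1)] Ec[OF ij(2)]])
      fix v :: "'a vec" assume v: "v \<in> carrier_vec n"
      have Ejv: "E j *\<^sub>v v \<in> carrier_vec n"
        using Ec[OF ij(2)] v by simp
      have "(A *\<^sub>v (E j *\<^sub>v v)) $ \<tau> i = (\<Sum>c\<in>{0..<n}. A $$ (\<tau> i, c) * (E j *\<^sub>v v) $ c)"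
        using A_index[OF Ejv] \<tau>[OF ij(1)] by (simp add: n_def)
      also have "\<dots> = 0"
        using zero by (intro sum.neutral) (simp add: Ev[OF ij(2) v] del: index_mult_mat_vec)
      finally have AEjv: "(A *\<^sub>v (E j *\<^sub>v v)) $ \<tau> i = 0" .
      have "E i *\<^sub>v (A *\<^sub>v (E j *\<^sub>v v)) = 0\<^sub>v n"
      proof (rule eq_vecI)
        fix r assume "r < dim_vec (0\<^sub>v n :: 'a vec)"
        then show "(E i *\<^sub>v (A *\<^sub>v (E j *\<^sub>v v))) $ r = (0\<^sub>v n) $ r"
          using Ev[OF ij(1), of "A *\<^sub>v (E j *\<^sub>v v)" r] AEjv A(1) Ejv
          by (simp del: index_mult_mat_vec)
      qed (use Ec[OF ij(1)] in simp)
      moreover have "(E i * A * E j) *\<^sub>v v = E i *\<^sub>v (A *\<^sub>v (E j *\<^sub>v v))"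
        using assoc_mult_mat_vec[OF Ec[OF ij(1)] A(1) Ejv]
          assoc_mult_mat_vec[OF mult_carrier_mat[OF Ec[OF ij(1)] A(1)] Ec[OF ij(2)] v] by simp
      moreover have "0\<^sub>m n n *\<^sub>v v = 0\<^sub>v n"
        using v by auto
      ultimately show "(E i * A * E j) *\<^sub>v v = 0\<^sub>m n n *\<^sub>v v"
        by simp
    qed simp
    then show False
      using nz ij by (simp add: n_def)
  qed
  have \<tau>_id: "\<tau> i = i" if "i \<le> d" for i
    using that
  proof (induction i rule: less_induct)
    case (less i)
    show ?case
    proof (cases i)
      case 0
      \<comment> \<open>The condition \<open>D $$ (0, 0) = t 0\<close> is what anchors \<tau> at
        0.\<close>
      have "0 \<in> \<tau> ` {0..d}"
        using \<tau>_surj by simp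
      then obtain k where k: "k \<le> d" "\<tau> k = 0"
        by auto
      then have "t k = t 0"
        using \<tau>[OF k(1)] D(3) by simp
      then have "k = 0"
        by (rule inj_onD[OF inj]) (use k(1) in simp_all)
      then show ?thesis using k 0 by simp
    next
      case (Suc m)
      have m: "\<tau> m = m"
        using less.IH[of m] less.prems Suc by simp
      have "A $$ (\<tau> m, \<tau> i) \<noteq> 0"
        using A_nz[of m i] less.prems Suc by simp
      moreover have "\<tau> m < n" "\<tau> i < n"
        using \<tau>[of m] \<tau>[of i] less.prems Suc by (simp_all add: n_def)
      ultimately have "\<not> \<bar>int m - int (\<tau> i)\<bar> > 1"
        using A_zero[of m "\<tau> i"] m by auto
      \<comment> \<open>The positions \<open>m - 1\<close> and \<open>m\<close> are already the
        images of \<open>m - 1\<close> and \<open>m\<close>, which leaves \<open>Suc m\<close>. For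
        \<open>m = 0\<close> the truncated \<open>m - 1\<close> is \<open>m\<close> again, and the
        argument still applies.\<close>
      then have "\<tau> i = m - 1 \<or> \<tau> i = m \<or> \<tau> i = Suc m"
        by linarith
      moreover have "\<tau> i \<noteq> m"
      proof
        assume "\<tau> i = m"
        then have "\<tau> i = \<tau> m" using m by simp
        then have "i = m"
          by (rule inj_onD[OF \<tau>_inj]) (use less.prems Suc in simp_all)
        then show False using Suc by simp
      qed
      moreover have "\<tau> i \<noteq> m - 1"
      proof
        assume "\<tau> i = m - 1"
        moreover have "\<tau> (m - 1) = m - 1"
          using less.IH[of "m - 1"] less.prems Suc by simp
        ultimately have "\<tau> i = \<tau> (m - 1)" by simp
        then have "i = m - 1"
          by (rule inj_onD[OF \<tau>_inj]) (use less.prems Suc in simp_all)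
        then show False using Suc by simp
      qed
      ultimately show ?thesis using Suc by simp
    qed
  qed
  show "\<forall>i\<le>d. \<forall>j\<le>d. \<bar>int i - int j\<bar> = 1 \<longrightarrow> A $$ (i, j) \<noteq> 0"
  proof (intro allI impI)
    fix i j assume ij: "i \<le> d" "j \<le> d" "\<bar>int i - int j\<bar> = 1"
    then show "A $$ (i, j) \<noteq> 0"
      using A_nz[OF ij] \<tau>_id[of i] \<tau>_id[of j] by simp
  qed
  show "D = mat (d + 1) (d + 1) (\<lambda>(r, c). if r = c then t r else 0)"
  proof (rule eq_matI)
    fix r c assume "r < dim_row (mat (d + 1) (d + 1) (\<lambda>(r, c). if r = c then t r else 0))"
      "c < dim_col (mat (d + 1) (d + 1) (\<lambda>(r, c). if r = c then t r else 0))"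
    then have rc: "r < n" "c < n" by (simp_all add: n_def)
    then have "D $$ (r, r) = t r"
      using \<tau>[of r] \<tau>_id[of r] by (simp add: n_def)
    moreover have "r \<noteq> c \<Longrightarrow> D $$ (r, c) = 0"
      using D(1,2) rc by (simp add: diagonal_mat_def)
    ultimately show "D $$ (r, c) = mat (d + 1) (d + 1) (\<lambda>(r, c). if r = c then t r else 0) $$ (r, c)"
      using rc by (cases "r = c") (simp_all add: n_def)
  qed (use D(1) in \<open>simp_all add: n_def\<close>)
  show "idempotent_coords d (\<lambda>v k. v $ k) E"
  proof
    fix v :: "'a vec" assume "v \<in> carrier_vec (d + 1)" "\<And>j. j \<le> d \<Longrightarrow> v $ j = 0"
    then show "v = 0\<^sub>v (d + 1)"
      by (intro eq_vecI) auto
  next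
    fix v :: "'a vec" and i j assume "v \<in> carrier_vec (d + 1)" "i \<le> d" "j \<le> d"
    then show "(E i *\<^sub>v v) $ j = (if i = j then v $ j else 0)"
      using Ev[of i v j] \<tau>_id[of i] by (simp add: n_def)
  qed (use Ec in \<open>simp_all add: n_def\<close>)
qed

text \<open>Connects the coordinate lemmas with \<open>first_split_seq\<close>. The hypotheses speak
  of matrices, idempotents and eigenvalue sequences instead of \<open>leonard_system\<close>, so
  that both \<open>\<Phi>\<close> and \<open>down d \<Phi>\<close> can be inserted.\<close>

lemma leonard_coords_exists:
  fixes \<Phi> :: "'a::field leonard_data"
  assumes \<Phi>: "op \<Phi> \<in> carrier_mat (d + 1) (d + 1)" "tridiagonal_mat (op \<Phi>)"
    and irreducible: "\<forall>i\<le>d. \<forall>j\<le>d. \<bar>int i - int j\<bar> = 1 \<longrightarrow> op \<Phi> $$ (i, j) \<noteq> 0"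
    and D: "dual_op \<Phi> = mat (d + 1) (d + 1) (\<lambda>(r, c). if r = c then dual_eigenvalue_seq d \<Phi> r else 0)"
    and t_inj: "inj_on (dual_eigenvalue_seq d \<Phi>) {0..d}"
    and dual_coords: "idempotent_coords d (\<lambda>v k. v $ k) (dual_idem \<Phi>)"
    and assoc: "associated_eigenvalues d (op \<Phi>) (idem \<Phi>) (eigenvalue_seq d \<Phi>)"
    and zero: "\<forall>i\<le>d. \<forall>j\<le>d. \<bar>int i - int j\<bar> > 1 \<longrightarrow>
      idem \<Phi> i * dual_op \<Phi> * idem \<Phi> j = 0\<^sub>m (d + 1) (d + 1)"
  obtains \<beta> where
    "leonard_coords d \<beta> (op \<Phi>) (dual_op \<Phi>) (eigenvalue_seq d \<Phi>) (dual_eigenvalue_seq d \<Phi>)"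
    "\<And>i. 0 < i \<Longrightarrow> i \<le> d \<Longrightarrow> leonard_coords.split_val d \<beta> (op \<Phi>) (dual_op \<Phi>)
      (eigenvalue_seq d \<Phi>) (dual_eigenvalue_seq d \<Phi>) i = first_split_seq d \<Phi> i"
proof -
  obtain \<beta> where \<beta>: "idempotent_coords d \<beta> (idem \<Phi>)"
    and coord_A: "\<And>v k. v \<in> carrier_vec (d + 1) \<Longrightarrow> k \<le> d \<Longrightarrow>
      \<beta> (op \<Phi> *\<^sub>v v) k = eigenvalue_seq d \<Phi> k * \<beta> v k"
    by (rule idempotent_coords_exists[OF \<Phi>(1) assoc]) (rule that)
  interpret E: idempotent_coords d \<beta> "idem \<Phi>" by (rule \<beta>)
  interpret Es: idempotent_coords d "\<lambda>v k. v $ k" "dual_idem \<Phi>" by (rule dual_coords)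
  have Dc: "dual_op \<Phi> \<in> carrier_mat (d + 1) (d + 1)"
    by (simp add: D)
  have \<theta>_inj: "inj_on (eigenvalue_seq d \<Phi>) {0..d}"
    using assoc by (simp add: associated_eigenvalues_def eigenvalue_ordering_def bij_betw_def)
  interpret leonard_coords d \<beta> "op \<Phi>" "dual_op \<Phi>" "eigenvalue_seq d \<Phi>" "dual_eigenvalue_seq d \<Phi>"
  proof
    show "op \<Phi> $$ (Suc i, i) \<noteq> 0" if "i < d" for i
      using irreducible that by simp
    show "op \<Phi> $$ (i, Suc i) \<noteq> 0" if "i < d" for i
      using irreducible that by simp
    show "\<beta> (dual_op \<Phi> *\<^sub>v v) i = 0"
      if "v \<in> carrier_vec (d + 1)" "i \<le> d"
        "\<And>j. j \<le> d \<Longrightarrow> j \<le> i + 1 \<Longrightarrow> i \<le> j + 1 \<Longrightarrow> \<beta> v j = 0" for v i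
      by (rule E.coord_tridiagonal[OF Dc _ that]) (use zero in simp_all)
  qed (fact \<Phi> D t_inj \<theta>_inj E.coord_add E.coord_smult E.coord_inj coord_A)+
  \<comment> \<open>By \<open>idem_image_sum_eq\<close> the dual idempotents give the condition on
    the entries beyond \<open>i\<close>, and the idempotents give the one on the \<beta>-coordinates
    below \<open>i\<close>.\<close>
  have "split_space d \<Phi> i = U i" if "i \<le> d" for i
    using that
    by (auto simp: split_space_def U_def E.idem_image_sum_eq[of "{i..d}"]
        Es.idem_image_sum_eq[of "{0..i}"])
  then have "split_val i = first_split_seq d \<Phi> i" if "i \<le> d" for i
    using that by (simp add: split_val_def first_split_seq_def)
  then show thesis
    by (intro that[OF leonard_coords_axioms]) simp_all
qed

theorem theorem21p3:
  fixes d :: nat and \<Phi> :: "'a::field leonard_data" and p :: "'a param_array"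
  assumes "leonard_system d \<Phi>"
    and "TD_D_canonical d \<Phi>"
    and "p = parameter_array d \<Phi>"
  shows "op \<Phi> = matrix_T d p \<and> dual_op \<Phi> = matrix_D d p"
proof -
  let ?A = "op \<Phi>" and ?D = "dual_op \<Phi>" and ?\<Psi> = "down d \<Phi>"
  let ?\<theta> = "eigenvalue_seq d \<Phi>" and ?t = "dual_eigenvalue_seq d \<Phi>"
  have down [simp]: "op ?\<Psi> = ?A" "dual_op ?\<Psi> = ?D" "dual_idem ?\<Psi> = dual_idem \<Phi>"
    "idem ?\<Psi> = (\<lambda>i. idem \<Phi> (d - i))" "dual_eigenvalue_seq d ?\<Psi> = ?t"
    by (simp_all add: down_def dual_eigenvalue_seq_def)
  have A: "?A \<in> carrier_mat (d + 1) (d + 1)" "tridiagonal_mat ?A"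
    and D: "?D \<in> carrier_mat (d + 1) (d + 1)" "diagonal_mat ?D" "?D $$ (0, 0) = ?t 0"
    and rows: "\<And>i. i \<le> d \<Longrightarrow> (\<Sum>j\<in>{0..d}. ?A $$ (i, j)) = ?\<theta> 0"
    using assms(2) by (auto simp: TD_D_canonical_def)
  have seqs: "idempotent_sequence d ?A ?D (idem \<Phi>)" "idempotent_sequence d ?D ?A (dual_idem \<Phi>)"
    using assms(1) by (auto simp: leonard_system_def)
  have assoc: "associated_eigenvalues d ?A (idem \<Phi>) ?\<theta>"
    using seqs(1) someI_ex[of "associated_eigenvalues d ?A (idem \<Phi>)"]
    by (simp add: idempotent_sequence_def eigenvalue_seq_def)
  have dual_assoc: "associated_eigenvalues d ?D (dual_idem \<Phi>) ?t"
    using seqs(2) someI_ex[of "associated_eigenvalues d ?D (dual_idem \<Phi>)"]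
    by (simp add: idempotent_sequence_def dual_eigenvalue_seq_def)
  \<comment> \<open>\<open>eigenvalue_seq\<close> of the reversed system is a separate choice; the
    reversed sequence shows that something can be chosen.\<close>
  have down_assoc: "associated_eigenvalues d ?A (idem ?\<Psi>) (eigenvalue_seq d ?\<Psi>)"
  proof -
    have "associated_eigenvalues d ?A (idem ?\<Psi>) (\<lambda>i. ?\<theta> (d - i))"
      using associated_eigenvalues_rev[OF A(1) assoc] by simp
    then have "associated_eigenvalues d ?A (idem ?\<Psi>) (SOME \<theta>. associated_eigenvalues d ?A (idem ?\<Psi>) \<theta>)"
      by (rule someI[of "associated_eigenvalues d ?A (idem ?\<Psi>)"])
    then show ?thesis
      by (simp add: eigenvalue_seq_def)
  qed
  \<comment> \<open>The last idempotent of the reversed system is the first one of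
    \<open>\<Phi>\<close>, so both carry the same eigenvalue.\<close>
  have last: "eigenvalue_seq d ?\<Psi> d = ?\<theta> 0"
    using associated_eigenvalue_unique[OF A(1) down_assoc assoc, of d 0] by simp
  have zero: "\<forall>i\<le>d. \<forall>j\<le>d. \<bar>int i - int j\<bar> > 1 \<longrightarrow>
      idem \<Phi> i * ?D * idem \<Phi> j = 0\<^sub>m (d + 1) (d + 1)"
    using seqs(1) by (simp add: idempotent_sequence_def)
  have dual_nz: "\<forall>i\<le>d. \<forall>j\<le>d. \<bar>int i - int j\<bar> = 1 \<longrightarrow>
      dual_idem \<Phi> i * ?A * dual_idem \<Phi> j \<noteq> 0\<^sub>m (d + 1) (d + 1)"
    using seqs(2) by (simp add: idempotent_sequence_def)
  note D_eq = diagonal_mat_eigenvalue_order(1)[OF A D dual_assoc dual_nz]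
    and irreducible = diagonal_mat_eigenvalue_order(2)[OF A D dual_assoc dual_nz]
    and dual_coords = diagonal_mat_eigenvalue_order(3)[OF A D dual_assoc dual_nz]
  have t_inj: "inj_on ?t {0..d}"
    using dual_assoc by (simp add: associated_eigenvalues_def eigenvalue_ordering_def bij_betw_def)
  obtain \<beta> where lc: "leonard_coords d \<beta> ?A ?D ?\<theta> ?t"
    and \<phi>1: "\<And>i. 0 < i \<Longrightarrow> i \<le> d \<Longrightarrow>
      leonard_coords.split_val d \<beta> ?A ?D ?\<theta> ?t i = first_split_seq d \<Phi> i"
    by (rule leonard_coords_exists[OF A irreducible D_eq t_inj dual_coords assoc zero]) (rule that)
  have down_zero: "\<forall>i\<le>d. \<forall>j\<le>d. \<bar>int i - int j\<bar> > 1 \<longrightarrow>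
      idem ?\<Psi> i * ?D * idem ?\<Psi> j = 0\<^sub>m (d + 1) (d + 1)"
    using zero by (simp add: of_nat_diff)
  obtain \<gamma> where lc': "leonard_coords d \<gamma> ?A ?D (eigenvalue_seq d ?\<Psi>) ?t"
    and \<phi>2: "\<And>i. 0 < i \<Longrightarrow> i \<le> d \<Longrightarrow>
      leonard_coords.split_val d \<gamma> ?A ?D (eigenvalue_seq d ?\<Psi>) ?t i = second_split_seq d \<Phi> i"
    by (rule leonard_coords_exists[of ?\<Psi> d, unfolded down(1-3,5) second_split_seq_def[symmetric],
          OF A irreducible D_eq t_inj dual_coords down_assoc down_zero]) (rule that)
  \<comment> \<open>The two instances share both matrices and the dual eigenvalues; they differ in
    the eigenvalue order and in the coordinates.\<close>
  interpret up: leonard_coords d \<beta> ?A ?D ?\<theta> ?t by (rule lc)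
  interpret dn: leonard_coords d \<gamma> ?A ?D "eigenvalue_seq d ?\<Psi>" ?t by (rule lc')
  \<comment> \<open>The row sum condition, read as an eigenvector equation.\<close>
  have "?A *\<^sub>v up.ones = ?\<theta> 0 \<cdot>\<^sub>v up.ones"
  proof (rule eq_vecI)
    fix i assume "i < dim_vec (?\<theta> 0 \<cdot>\<^sub>v up.ones)"
    then have i: "i \<le> d" by (simp add: up.ones_def)
    then have "(?A *\<^sub>v up.ones) $ i = (\<Sum>j\<in>{0..<d + 1}. ?A $$ (i, j))"
      using A(1) by (simp add: up.ones_def scalar_prod_def)
    also have "\<dots> = ?\<theta> 0"
      using rows[OF i] by (simp only: atLeastLessThanSuc_atLeastAtMost Suc_eq_plus1[symmetric])
    finally show "(?A *\<^sub>v up.ones) $ i = (?\<theta> 0 \<cdot>\<^sub>v up.ones) $ i"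
      using i by (simp add: up.ones_def)
  qed (use A(1) in \<open>simp add: up.ones_def\<close>)
  \<comment> \<open>In the reversed system the same eigenvalue has index \<open>d\<close>, as
    \<open>sub_entry_split_val\<close> requires.\<close>
  note eig = this and eig' = this[folded last]
  have "?A = matrix_T d p"
  proof (rule eq_matI)
    fix i j assume "i < dim_row (matrix_T d p)" "j < dim_col (matrix_T d p)"
    then have ij: "i \<le> d" "j \<le> d"
      by (auto simp: matrix_T_def Let_def)
    consider "i = j" | "j = i + 1" | "i = j + 1" | "\<bar>int i - int j\<bar> > 1"
      by linarith
    then show "?A $$ (i, j) = matrix_T d p $$ (i, j)"
    proof cases
      case 1
      then show ?thesis
        using up.diag_entry[OF eig ij(1)] ij \<phi>1[of i] \<phi>1[of "i + 1"] assms(3)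
        by (cases "i = 0"; cases "i = d") (simp_all add: matrix_T_def parameter_array_def Let_def)
    next
      case 2
      then show ?thesis
        using up.sup_entry[OF eig, of j] ij \<phi>1[of j] assms(3)
        by (simp add: matrix_T_def parameter_array_def Let_def)
    next
      case 3
      then show ?thesis
        using dn.sub_entry_split_val[OF eig', of i] ij \<phi>2[of i] assms(3)
        by (simp add: matrix_T_def parameter_array_def Let_def)
    next
      case 4
      then show ?thesis
        using A ij assms(3)
        by (auto simp: tridiagonal_mat_def matrix_T_def parameter_array_def Let_def)
    qed
  qed (use A(1) in \<open>auto simp: matrix_T_def Let_def\<close>)
  moreover have "?D = matrix_D d p"
    unfolding matrix_D_def assms(3) parameter_array_def param_array.simps by (rule D_eq)
  ultimately show ?thesis by blast
qed

end
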